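(* Fix $d\ge3$, $c>0$, $\delta<1$, let $p=(c+o_n(1))n^{-d+1+\delta}$, $\mathcal{H}$ the random $d$-uniform hypergraph on $[n]$ with each $d$-subset a hyperedge independently with probability $p$, and $\Psi=\mathrm{Proj}(\mathcal{H})$. Then $H(\Psi)=\Theta_n(n^{1+\delta}\log n)$, and \[ H(\mathcal{H}\mid\Psi)=\begin{cases} o_n(n^{1+\delta}) & \text{if }\delta<\frac{d-1}{d+1},\\ O_n(n^{1+\delta}) & \text{if }\delta=\frac{d-1}{d+1},\\ \Theta_n(n^{1+\delta}\log n) & \text{if }\delta>\frac{d-1}{d+1}.\end{cases} \]
   Context: $\mathrm{Proj}(H)$ is the graph on $[n]$ with $\{i,j\}$ an edge iff some hyperedge of $H$ contains $\{i,j\}$. $H(\cdot)$ denotes Shannon entropy (natural logarithm) and $H(\cdot\mid\cdot)$ conditional entropy. *)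

theory Defs
  imports "HOL-Probability.Probability" "HOL-Library.Landau_Symbols"
begin

definition d_subsets :: "nat \<Rightarrow> nat \<Rightarrow> nat set set" where
  "d_subsets d n = {e. e \<subseteq> {1..n} \<and> card e = d}"

text \<open>The sample space consists of one independent coin flip with success probability \<open>p\<close>
  for every \<open>d\<close>-subset of \<open>{1..n}\<close>.  Its carrier, the set of extensional functions on
  \<open>d_subsets d n\<close>, is finite.\<close>

definition coin_space :: "nat \<Rightarrow> nat \<Rightarrow> real \<Rightarrow> (nat set \<Rightarrow> bool) measure" where
  "coin_space d n p = (\<Pi>\<^sub>M e\<in>d_subsets d n. measure_pmf (bernoulli_pmf p))"

text \<open>The vertex set is always \<open>{1..n}\<close>, so a hypergraph is represented by its set of hyperedges
  and a graph by its set of edges (two-element sets of vertices).\<close>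

definition rand_hypergraph :: "nat \<Rightarrow> nat \<Rightarrow> (nat set \<Rightarrow> bool) \<Rightarrow> nat set set" where
  "rand_hypergraph d n \<omega> = {e \<in> d_subsets d n. \<omega> e}"

definition Proj :: "nat \<Rightarrow> nat set set \<Rightarrow> nat set set" where
  "Proj n H = {{i, j} | i j. i \<in> {1..n} \<and> j \<in> {1..n} \<and> i \<noteq> j \<and> (\<exists>h\<in>H. {i, j} \<subseteq> h)}"

text \<open>Shannon entropy in nats (base \<open>exp 1\<close>).  As in \<open>entropy_Pow\<close> and \<open>conditional_entropy_Pow\<close>,
  the reference measures are the counting measures on the ranges of the (finitely-valued)
  random variables.\<close>

definition shannon_entropy :: "'a measure \<Rightarrow> ('a \<Rightarrow> 'b) \<Rightarrow> real" where
  "shannon_entropy M X = prob_space.entropy M (exp 1) (count_space (X ` space M)) X"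

definition shannon_cond_entropy :: "'a measure \<Rightarrow> ('a \<Rightarrow> 'b) \<Rightarrow> ('a \<Rightarrow> 'c) \<Rightarrow> real" where
  "shannon_cond_entropy M X Y =
     prob_space.conditional_entropy M (exp 1)
       (count_space (X ` space M)) (count_space (Y ` space M)) X Y"

definition entropy_Proj :: "nat \<Rightarrow> nat \<Rightarrow> real \<Rightarrow> real" where
  "entropy_Proj d n p =
     shannon_entropy (coin_space d n p) (\<lambda>\<omega>. Proj n (rand_hypergraph d n \<omega>))"

definition cond_entropy_Proj :: "nat \<Rightarrow> nat \<Rightarrow> real \<Rightarrow> real" where
  "cond_entropy_Proj d n p =
     shannon_cond_entropy (coin_space d n p)
       (rand_hypergraph d n) (\<lambda>\<omega>. Proj n (rand_hypergraph d n \<omega>))"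

end

theory Submission
  imports Defs
begin

text \<open>Write \<open>D = d choose 2\<close> and \<open>q = ((n - 2) choose (d - 2)) p\<close>, the expected number of
  hyperedges through a given pair.

  Lower bound on the entropy of \<open>\<Psi>\<close>: the pairs of a graph \<open>G\<close> are covered one hyperedge at a time;
  each step costs a factor \<open>q\<close> and covers at most \<open>D\<close> pairs, so \<open>\<Psi> = G\<close> has probability at most
  \<open>q\<close> to the power \<open>card G / D\<close>.

  All upper bounds on entropies come from Gibbs' inequality.  For \<open>\<Psi>\<close>, comparing with the random
  graph of edge density \<open>q\<close> gives about \<open>(n choose d) p D ln (1 / q)\<close>.  This is smaller than the
  entropy of the hypergraph by a constant factor exactly if \<open>D (1 - \<delta>) < d - 1 - \<delta>\<close>, that is, if
  \<open>\<delta> > (d - 1) / (d + 1)\<close>, and the difference is the conditional entropy.  For the conditional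
  entropy, comparing with the model that keeps every \<open>d\<close>-clique of \<open>\<Psi>\<close> with probability \<open>s\<close> gives
  \<open>(n choose d) (p ln (1 / s) + r ln (1 / (1 - s)))\<close>, where \<open>r\<close> bounds the probability that a given
  \<open>d\<close>-set becomes a clique because of other hyperedges.  If \<open>\<delta> \<le> (d - 1) / (d + 1)\<close>, then \<open>r = O(p)\<close>,
  with \<open>r = o(p)\<close> if the inequality is strict, in which case \<open>s\<close> may be taken close to \<open>1\<close>.\<close>

section \<open>Entropies as finite sums\<close>

text \<open>The expectation of \<open>f\<close> at a random subset of \<open>U\<close> containing
  each element independently with probability \<open>p\<close>. As a finite sum it keeps measure
  theory out of nearly all later arguments, and the ground set can shrink to \<open>U - {e}\<close>
  when one coin is set aside.\<close>

definition coin_mean :: "real \<Rightarrow> 'a set \<Rightarrow> ('a set \<Rightarrow> real) \<Rightarrow> real" where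
  "coin_mean p U f = (\<Sum>H\<in>Pow U. p ^ card H * (1 - p) ^ card (U - H) * f H)"

definition coin_prob :: "real \<Rightarrow> 'a set \<Rightarrow> ('a set \<Rightarrow> bool) \<Rightarrow> real" where
  "coin_prob p U A = coin_mean p U (\<lambda>H. of_bool (A H))"

lemma finite_d_subsets [simp]: "finite (d_subsets d n)"
  unfolding d_subsets_def by (rule finite_subset[of _ "Pow {1..n}"]) auto

lemma card_d_subsets: "card (d_subsets d n) = n choose d"
  unfolding d_subsets_def using n_subsets[of "{1..n}" d] by simp

lemma space_coin_space: "space (coin_space d n p) = PiE (d_subsets d n) (\<lambda>_. UNIV)"
  by (simp add: coin_space_def space_PiM)

lemma sets_coin_space: "sets (coin_space d n p) = Pow (space (coin_space d n p))"
proof -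
  have "sets (coin_space d n p) = sets (PiM (d_subsets d n) (\<lambda>_. count_space (UNIV :: bool set)))"
    unfolding coin_space_def by (rule sets_PiM_cong) auto
  also have "\<dots> = Pow (PiE (d_subsets d n) (\<lambda>_. UNIV))"
    by (subst count_space_PiM_finite) auto
  finally show ?thesis by (simp add: space_coin_space)
qed

lemma finite_space_coin_space: "finite (space (coin_space d n p))"
  by (simp add: space_coin_space finite_PiE)

lemma prob_space_coin_space: "prob_space (coin_space d n p)"
  unfolding coin_space_def by (intro prob_space_PiM) (auto intro: measure_pmf.prob_space_axioms)

lemma simple_function_coin_space: "simple_function (coin_space d n p) X"
  unfolding simple_function_def by (auto simp: sets_coin_space finite_space_coin_space)

lemma prob_coin_space_singleton:
  assumes "\<omega> \<in> space (coin_space d n p)" "0 \<le> p" "p \<le> 1"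
  shows "measure (coin_space d n p) {\<omega>} =
    p ^ card (rand_hypergraph d n \<omega>) * (1 - p) ^ card (d_subsets d n - rand_hypergraph d n \<omega>)"
proof -
  let ?U = "d_subsets d n"
  interpret product_prob_space "\<lambda>_. measure_pmf (bernoulli_pmf p)" ?U
    by unfold_locales
  interpret finite_product_prob_space "\<lambda>_. measure_pmf (bernoulli_pmf p)" ?U
    by unfold_locales auto
  have eq: "{\<omega>} = PiE ?U (\<lambda>e. {\<omega> e})"
    using assms(1) by (intro PiE_singleton[symmetric]) (auto simp: space_coin_space PiE_def)
  have "measure (coin_space d n p) {\<omega>} = (\<Prod>e\<in>?U. measure (measure_pmf (bernoulli_pmf p)) {\<omega> e})"
    unfolding coin_space_def eq by (rule prob_times) auto
  also have "\<dots> = (\<Prod>e\<in>?U. if \<omega> e then p else 1 - p)"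
    using assms by (intro prod.cong) (auto simp: measure_pmf_single)
  also have "\<dots> = p ^ card {e\<in>?U. \<omega> e} * (1 - p) ^ card {e\<in>?U. \<not> \<omega> e}"
    by (subst prod.If_cases) (auto simp: Int_def)
  also have "{e\<in>?U. \<not> \<omega> e} = ?U - rand_hypergraph d n \<omega>"
    by (auto simp: rand_hypergraph_def)
  finally show ?thesis by (simp add: rand_hypergraph_def)
qed

lemma bij_betw_rand_hypergraph:
  "bij_betw (rand_hypergraph d n) (space (coin_space d n p)) (Pow (d_subsets d n))"
proof (rule bij_betwI[where g = "\<lambda>H. restrict (\<lambda>e. e \<in> H) (d_subsets d n)"])
  show "(\<lambda>e\<in>d_subsets d n. e \<in> rand_hypergraph d n \<omega>) = \<omega>" if "\<omega> \<in> space (coin_space d n p)" for \<omega>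
    using that by (auto simp: space_coin_space rand_hypergraph_def fun_eq_iff PiE_def extensional_def)
qed (auto simp: space_coin_space rand_hypergraph_def)

lemma sum_coin_space:
  assumes "0 \<le> p" "p \<le> 1"
  shows "(\<Sum>\<omega>\<in>space (coin_space d n p). measure (coin_space d n p) {\<omega>} * f (rand_hypergraph d n \<omega>)) =
    coin_mean p (d_subsets d n) f"
  unfolding coin_mean_def
  by (subst sum.reindex_bij_betw[OF bij_betw_rand_hypergraph[where p = p], symmetric])
     (simp add: prob_coin_space_singleton assms)

lemma prob_coin_space:
  assumes "0 \<le> p" "p \<le> 1"
  shows "measure (coin_space d n p) {\<omega> \<in> space (coin_space d n p). A (rand_hypergraph d n \<omega>)} =
    coin_prob p (d_subsets d n) A"
proof -
  let ?M = "coin_space d n p"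
  interpret prob_space ?M by (rule prob_space_coin_space)
  have "prob {\<omega> \<in> space ?M. A (rand_hypergraph d n \<omega>)} =
      (\<Sum>\<omega>\<in>{\<omega> \<in> space ?M. A (rand_hypergraph d n \<omega>)}. prob {\<omega>})"
    by (intro finite_measure_eq_sum_singleton) (auto simp: sets_coin_space finite_space_coin_space)
  also have "\<dots> = (\<Sum>\<omega>\<in>space ?M. prob {\<omega>} * of_bool (A (rand_hypergraph d n \<omega>)))"
    by (intro sum.mono_neutral_cong_left) (auto simp: finite_space_coin_space)
  finally show ?thesis
    by (simp add: coin_prob_def sum_coin_space[OF assms, symmetric])
qed

lemma information_space_coin_space: "information_space (coin_space d n p) (exp 1)"
  by (intro information_space.intro prob_space_coin_space information_space_axioms.intro) simp

text \<open>Entropy as the mean surprisal of the observed value. Averaging over \<open>H\<close>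
  rather than over the values of \<open>F\<close> lets entropies be compared pointwise in
  \<open>H\<close>.\<close>

definition coin_entropy :: "real \<Rightarrow> 'a set \<Rightarrow> ('a set \<Rightarrow> 'b) \<Rightarrow> real" where
  "coin_entropy p U F = coin_mean p U (\<lambda>H. - ln (coin_prob p U (\<lambda>H'. F H' = F H)))"

text \<open>The probability of a value is the sum over its fibre, so the sum over values regroups
  into a sum over outcomes.\<close>

lemma shannon_entropy_coin_space:
  assumes "0 \<le> p" "p \<le> 1"
  shows "shannon_entropy (coin_space d n p) (F \<circ> rand_hypergraph d n) =
    coin_entropy p (d_subsets d n) F"
proof -
  let ?M = "coin_space d n p" and ?X = "F \<circ> rand_hypergraph d n"
  interpret information_space ?M "exp 1" by (rule information_space_coin_space)
  define P where "P x = prob (?X -` {x} \<inter> space ?M)" for x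
  have P_eq: "P x = coin_prob p (d_subsets d n) (\<lambda>H. F H = x)" for x
    unfolding P_def prob_coin_space[OF assms, symmetric] by (rule arg_cong[where f = prob]) auto
  have P_sum: "P x = (\<Sum>\<omega>\<in>{\<omega>\<in>space ?M. ?X \<omega> = x}. prob {\<omega>})" for x
    unfolding P_def
    by (subst finite_measure_eq_sum_singleton)
       (auto simp: sets_coin_space finite_space_coin_space intro!: sum.cong)
  have "shannon_entropy ?M ?X = - (\<Sum>x\<in>?X ` space ?M. P x * ln (P x))"
    unfolding shannon_entropy_def P_def
    using entropy_simple_distributed[OF simple_distributedI[OF simple_function_coin_space measure_nonneg refl], of ?X]
    by (simp add: log_def)
  also have "\<dots> = - (\<Sum>x\<in>?X ` space ?M. \<Sum>\<omega>\<in>{\<omega>\<in>space ?M. ?X \<omega> = x}. prob {\<omega>} * ln (P (?X \<omega>)))"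
    by (intro arg_cong[where f = uminus] sum.cong refl, subst (1) P_sum)
       (simp add: sum_distrib_right)
  also have "\<dots> = - (\<Sum>\<omega>\<in>space ?M. prob {\<omega>} * ln (P (?X \<omega>)))"
    by (subst sum.group) (auto simp: finite_space_coin_space)
  also have "\<dots> = (\<Sum>\<omega>\<in>space ?M. prob {\<omega>} *
      (\<lambda>H. - ln (coin_prob p (d_subsets d n) (\<lambda>H'. F H' = F H))) (rand_hypergraph d n \<omega>))"
    by (simp add: P_eq sum_negf)
  also have "\<dots> = coin_entropy p (d_subsets d n) F"
    unfolding coin_entropy_def by (rule sum_coin_space[OF assms])
  finally show ?thesis .
qed

lemma entropy_Proj_eq:
  assumes "0 \<le> p" "p \<le> 1"
  shows "entropy_Proj d n p = coin_entropy p (d_subsets d n) (Proj n)"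
  using shannon_entropy_coin_space[OF assms, of d n "Proj n"] by (simp add: entropy_Proj_def comp_def)

text \<open>The chain rule: the projection is a function of the hypergraph, so adjoining it to the
  hypergraph adds no entropy.\<close>

lemma cond_entropy_Proj_eq:
  assumes "0 \<le> p" "p \<le> 1"
  shows "cond_entropy_Proj d n p =
    coin_entropy p (d_subsets d n) (\<lambda>H. H) - coin_entropy p (d_subsets d n) (Proj n)"
proof -
  interpret information_space "coin_space d n p" "exp 1" by (rule information_space_coin_space)
  show ?thesis
    using entropy_partition[OF simple_function_coin_space, of "rand_hypergraph d n" "Proj n"]
      shannon_entropy_coin_space[OF assms, of d n "Proj n"]
      shannon_entropy_coin_space[OF assms, of d n "\<lambda>H. H"]
    by (simp add: cond_entropy_Proj_def shannon_cond_entropy_def shannon_entropy_def comp_def)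
qed

section \<open>Independent coin flips and Gibbs' inequality\<close>

lemma coin_mean_mono:
  assumes "0 \<le> p" "p \<le> 1" "\<And>H. H \<subseteq> U \<Longrightarrow> f H \<le> g H"
  shows "coin_mean p U f \<le> coin_mean p U g"
  unfolding coin_mean_def using assms by (intro sum_mono mult_left_mono) auto

lemma coin_mean_cong:
  "(\<And>H. H \<subseteq> U \<Longrightarrow> f H = g H) \<Longrightarrow> coin_mean p U f = coin_mean p U g"
  unfolding coin_mean_def by (intro sum.cong) auto

lemma coin_mean_add: "coin_mean p U (\<lambda>H. f H + g H) = coin_mean p U f + coin_mean p U g"
  by (simp add: coin_mean_def sum.distrib algebra_simps)

lemma coin_mean_diff: "coin_mean p U (\<lambda>H. f H - g H) = coin_mean p U f - coin_mean p U g"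
  by (simp add: coin_mean_def sum_subtractf algebra_simps)

lemma coin_mean_cmult: "coin_mean p U (\<lambda>H. f H * c) = coin_mean p U f * c"
  by (simp add: coin_mean_def sum_distrib_right mult.assoc)

lemma coin_mean_sum: "coin_mean p U (\<lambda>H. \<Sum>i\<in>I. f i H) = (\<Sum>i\<in>I. coin_mean p U (f i))"
  unfolding coin_mean_def by (subst sum.swap) (simp add: sum_distrib_left)

text \<open>Condition on the coin of \<open>e\<close>. This recursion underlies the independence
  facts below.\<close>

lemma coin_mean_insert:
  assumes "finite U" "e \<notin> U"
  shows "coin_mean p (insert e U) f =
    p * coin_mean p U (\<lambda>H. f (insert e H)) + (1 - p) * coin_mean p U f"
proof -
  let ?w = "\<lambda>H. p ^ card H * (1 - p) ^ card (insert e U - H) * f H"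
  have "coin_mean p (insert e U) f = (\<Sum>H\<in>Pow U. ?w H) + (\<Sum>H\<in>insert e ` Pow U. ?w H)"
    unfolding coin_mean_def Pow_insert using assms by (intro sum.union_disjoint) auto
  also have "(\<Sum>H\<in>insert e ` Pow U. ?w H) = (\<Sum>H\<in>Pow U. ?w (insert e H))"
    using assms(2) by (intro sum.reindex[unfolded o_def] inj_onI) (auto simp: insert_ident subset_iff)
  also have "\<dots> = p * coin_mean p U (\<lambda>H. f (insert e H))"
    unfolding coin_mean_def sum_distrib_left
  proof (intro sum.cong refl)
    fix H assume "H \<in> Pow U"
    then have "finite H" "e \<notin> H"
      using assms finite_subset by auto
    then have "card (insert e H) = Suc (card H)" "insert e U - insert e H = U - H"
      using assms by auto
    then show "?w (insert e H) = p * (p ^ card H * (1 - p) ^ card (U - H) * f (insert e H))"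
      by simp
  qed
  also have "(\<Sum>H\<in>Pow U. ?w H) = (1 - p) * coin_mean p U f"
    unfolding coin_mean_def sum_distrib_left
  proof (intro sum.cong refl)
    fix H assume "H \<in> Pow U"
    then have "card (insert e U - H) = Suc (card (U - H))"
      using assms by (subst insert_Diff_if) auto
    then show "?w H = (1 - p) * (p ^ card H * (1 - p) ^ card (U - H) * f H)"
      by simp
  qed
  finally show ?thesis by simp
qed

lemma coin_mean_const [simp]: "finite U \<Longrightarrow> coin_mean p U (\<lambda>_. c) = c"
proof (induction U rule: finite_induct)
  case empty
  show ?case by (simp add: coin_mean_def)
next
  case (insert e U)
  then show ?case by (simp add: coin_mean_insert algebra_simps)
qed

text \<open>A function that ignores \<open>e\<close> is independent of the coin of \<open>e\<close>;
  passing to the ground set \<open>U - {e}\<close> makes this explicit.\<close>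

lemma coin_mean_indep:
  assumes "finite U" "e \<in> U" "\<And>H. H \<subseteq> U - {e} \<Longrightarrow> f (insert e H) = f H"
  shows "coin_mean p U f = coin_mean p (U - {e}) f"
    and "coin_mean p U (\<lambda>H. of_bool (e \<in> H) * f H) = p * coin_mean p (U - {e}) f"
    and "coin_mean p U (\<lambda>H. of_bool (e \<notin> H) * f H) = (1 - p) * coin_mean p (U - {e}) f"
proof -
  have U: "coin_mean p U g = p * coin_mean p (U - {e}) (\<lambda>H. g (insert e H)) + (1 - p) * coin_mean p (U - {e}) g" for g
    using coin_mean_insert[of "U - {e}" e p g] assms(1,2) by (simp add: insert_absorb)
  have f: "coin_mean p (U - {e}) (\<lambda>H. f (insert e H)) = coin_mean p (U - {e}) f"
    by (intro coin_mean_cong assms(3))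
  have e: "coin_mean p (U - {e}) (\<lambda>H. of_bool (e \<in> H) * f H) = 0"
    "coin_mean p (U - {e}) (\<lambda>H. of_bool (e \<notin> H) * f H) = coin_mean p (U - {e}) f"
    unfolding coin_mean_def by (auto intro!: sum.neutral sum.cong)
  have e': "coin_mean p (U - {e}) (\<lambda>H. 0) = 0"
    by (simp add: coin_mean_def)
  show "coin_mean p U f = coin_mean p (U - {e}) f"
    by (simp add: U f algebra_simps)
  show "coin_mean p U (\<lambda>H. of_bool (e \<in> H) * f H) = p * coin_mean p (U - {e}) f"
    by (subst U) (simp add: f e)
  show "coin_mean p U (\<lambda>H. of_bool (e \<notin> H) * f H) = (1 - p) * coin_mean p (U - {e}) f"
    by (subst U) (simp add: e e')
qed

lemma coin_prob_le_1: "finite U \<Longrightarrow> 0 \<le> p \<Longrightarrow> p \<le> 1 \<Longrightarrow> coin_prob p U A \<le> 1"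
  using coin_mean_mono[of p U "\<lambda>H. of_bool (A H)" "\<lambda>_. 1"] by (simp add: coin_prob_def)

lemma coin_prob_nonneg: "finite U \<Longrightarrow> 0 \<le> p \<Longrightarrow> p \<le> 1 \<Longrightarrow> 0 \<le> coin_prob p U A"
  using coin_mean_mono[of p U "\<lambda>_. 0" "\<lambda>H. of_bool (A H)"] by (simp add: coin_prob_def)

lemma coin_prob_mono:
  assumes "0 \<le> p" "p \<le> 1" "\<And>H. H \<subseteq> U \<Longrightarrow> A H \<Longrightarrow> B H"
  shows "coin_prob p U A \<le> coin_prob p U B"
  unfolding coin_prob_def using assms by (intro coin_mean_mono) auto

lemma coin_mean_card_set:
  assumes "finite V" "\<And>H. H \<subseteq> U \<Longrightarrow> F H \<subseteq> V"
  shows "coin_mean p U (\<lambda>H. real (card (F H))) = (\<Sum>v\<in>V. coin_prob p U (\<lambda>H. v \<in> F H))"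
proof -
  have "real (card (F H)) = (\<Sum>v\<in>V. of_bool (v \<in> F H))" if "H \<subseteq> U" for H
    using assms(1) assms(2)[OF that] by (simp add: Int_absorb1 Int_commute)
  then show ?thesis
    unfolding coin_prob_def coin_mean_sum[symmetric] by (intro coin_mean_cong) auto
qed

lemma coin_prob_mem: "finite U \<Longrightarrow> e \<in> U \<Longrightarrow> coin_prob p U (\<lambda>H. e \<in> H) = p"
  using coin_mean_indep(2)[of U e "\<lambda>_. 1" p] by (simp add: coin_prob_def)

lemma coin_mean_card: "finite U \<Longrightarrow> coin_mean p U (\<lambda>H. real (card H)) = real (card U) * p"
  by (subst coin_mean_card_set[of U]) (simp_all add: coin_prob_mem)

lemma coin_prob_disjoint:
  assumes "finite U" "V \<subseteq> U"
  shows "coin_prob p U (\<lambda>H. H \<inter> V = {}) = (1 - p) ^ card V"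
proof -
  have "finite V" using assms finite_subset by blast
  then show ?thesis using assms
  proof (induction V arbitrary: U rule: finite_induct)
    case empty
    then show ?case by (simp add: coin_prob_def)
  next
    case (insert e V)
    have "coin_prob p U (\<lambda>H. H \<inter> insert e V = {}) = coin_mean p U (\<lambda>H. of_bool (e \<notin> H) * of_bool (H \<inter> V = {}))"
      unfolding coin_prob_def by (intro coin_mean_cong) auto
    also have "\<dots> = (1 - p) * coin_mean p (U - {e}) (\<lambda>H. of_bool (H \<inter> V = {}))"
      using insert.hyps insert.prems by (intro coin_mean_indep(3)) auto
    also have "\<dots> = (1 - p) * (1 - p) ^ card V"
      using insert.IH[of "U - {e}"] insert.prems insert.hyps by (simp add: coin_prob_def subset_Diff_insert)
    finally show ?case using insert.hyps by simp
  qed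
qed

section \<open>Point probabilities and Gibbs' inequality\<close>

lemma coin_prob_eq:
  assumes "finite U" "H \<subseteq> U"
  shows "coin_prob p U (\<lambda>H'. H' = H) = p ^ card H * (1 - p) ^ card (U - H)"
proof -
  have "coin_prob p U (\<lambda>H'. H' = H) = (\<Sum>H'\<in>Pow U. if H' = H then p ^ card H * (1 - p) ^ card (U - H) else 0)"
    unfolding coin_prob_def coin_mean_def by (intro sum.cong) auto
  then show ?thesis using assms by simp
qed

lemma coin_prob_eq_sum:
  assumes "finite U"
  shows "coin_prob p U A = (\<Sum>H\<in>{H\<in>Pow U. A H}. p ^ card H * (1 - p) ^ card (U - H))"
  unfolding coin_prob_def coin_mean_def using assms
  by (intro sum.mono_neutral_cong_right) auto

lemma coin_prob_pos:
  assumes "finite U" "0 < p" "p < 1" "H \<subseteq> U" "A H"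
  shows "0 < coin_prob p U A"
  unfolding coin_prob_eq_sum[OF assms(1)] using assms
  by (intro sum_pos2[of _ H]) (auto intro!: mult_pos_pos)

text \<open>From \<open>ln x \<le> x - 1\<close>. Both Gibbs bounds below take for \<open>w\<close>
  the likelihood ratio of a comparison model to the true law.\<close>

lemma coin_mean_ln_le:
  assumes "finite U" "0 < p" "p < 1" "\<And>H. H \<subseteq> U \<Longrightarrow> 0 < w H" "coin_mean p U w \<le> 1"
  shows "coin_mean p U (\<lambda>H. ln (w H)) \<le> 0"
proof -
  have "coin_mean p U (\<lambda>H. ln (w H)) \<le> coin_mean p U (\<lambda>H. w H - 1)"
    using assms ln_le_minus_one by (intro coin_mean_mono) auto
  then show ?thesis using assms by (simp add: coin_mean_diff)
qed

text \<open>Gibbs' inequality for the law of \<open>F\<close>. Total mass at most 1 on the attained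
  values suffices, so \<open>Q\<close> may come from a model living on a larger set.\<close>

lemma coin_entropy_le:
  assumes "finite U" "0 < p" "p < 1"
    and pos: "\<And>H. H \<subseteq> U \<Longrightarrow> 0 < Q (F H)" and le: "(\<Sum>x\<in>F ` Pow U. Q x) \<le> 1"
  shows "coin_entropy p U F \<le> coin_mean p U (\<lambda>H. - ln (Q (F H)))"
proof -
  define P where "P x = coin_prob p U (\<lambda>H. F H = x)" for x
  let ?m = "\<lambda>H. p ^ card H * (1 - p) ^ card (U - H)"
  have Ppos: "0 < P (F H)" if "H \<subseteq> U" for H
    unfolding P_def using assms that by (intro coin_prob_pos) auto
  \<comment> \<open>Grouped by the value of \<open>F\<close>, the fibre probability
    \<open>P x\<close> cancels and only the total weight of \<open>Q\<close> is left.\<close>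
  have "coin_mean p U (\<lambda>H. Q (F H) / P (F H)) =
      (\<Sum>x\<in>F ` Pow U. \<Sum>H\<in>{H\<in>Pow U. F H = x}. ?m H * (Q (F H) / P (F H)))"
    unfolding coin_mean_def using assms(1) by (subst sum.group) auto
  also have "\<dots> = (\<Sum>x\<in>F ` Pow U. Q x)"
  proof (intro sum.cong refl)
    fix x assume "x \<in> F ` Pow U"
    then have "P x > 0" using Ppos by auto
    have "(\<Sum>H\<in>{H\<in>Pow U. F H = x}. ?m H * (Q (F H) / P (F H))) = P x * (Q x / P x)"
      unfolding P_def coin_prob_eq_sum[OF assms(1)] sum_distrib_right by (intro sum.cong) auto
    then show "(\<Sum>H\<in>{H\<in>Pow U. F H = x}. ?m H * (Q (F H) / P (F H))) = Q x"
      using \<open>P x > 0\<close> by simp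
  qed
  finally have "coin_mean p U (\<lambda>H. ln (Q (F H) / P (F H))) \<le> 0"
    using le assms Ppos by (intro coin_mean_ln_le) auto
  moreover have "coin_mean p U (\<lambda>H. ln (Q (F H) / P (F H))) =
      coin_mean p U (\<lambda>H. - ln (P (F H)) - (- ln (Q (F H))))"
  proof (intro coin_mean_cong)
    fix H assume "H \<subseteq> U"
    then show "ln (Q (F H) / P (F H)) = - ln (P (F H)) - (- ln (Q (F H)))"
      using pos[of H] Ppos[of H] by (simp add: ln_div)
  qed
  ultimately show ?thesis
    unfolding coin_mean_diff by (simp add: coin_entropy_def P_def)
qed

text \<open>The conditional Gibbs inequality: the left side is the entropy of \<open>H\<close> given
  \<open>F H\<close>, and \<open>Q\<close> models \<open>H\<close> given that value, with mass at
  most 1 on each fibre.\<close>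

lemma coin_entropy_diff_le:
  assumes "finite U" "0 < p" "p < 1"
    and pos: "\<And>H. H \<subseteq> U \<Longrightarrow> 0 < Q H"
    and le: "\<And>x. (\<Sum>H\<in>{H\<in>Pow U. F H = x}. Q H) \<le> 1"
  shows "coin_entropy p U (\<lambda>H. H) - coin_entropy p U F \<le> coin_mean p U (\<lambda>H. - ln (Q H))"
proof -
  define P where "P x = coin_prob p U (\<lambda>H. F H = x)" for x
  let ?m = "\<lambda>H. p ^ card H * (1 - p) ^ card (U - H)"
  have Ppos: "0 < P (F H)" if "H \<subseteq> U" for H
    unfolding P_def using assms that by (intro coin_prob_pos) auto
  have mpos: "0 < ?m H" for H using assms by simp
  have Psum: "(\<Sum>x\<in>F ` Pow U. P x) = 1"
  proof -
    have "(\<Sum>x\<in>F ` Pow U. P x) = (\<Sum>H\<in>Pow U. ?m H)"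
      unfolding P_def coin_prob_eq_sum[OF assms(1)] using assms(1) by (subst sum.group) auto
    also have "\<dots> = coin_mean p U (\<lambda>_. 1)" by (simp add: coin_mean_def)
    finally show ?thesis using assms(1) by simp
  qed
  \<comment> \<open>The comparison model draws the value of \<open>F\<close> from its true law and
    then \<open>H\<close> within the fibre with weight \<open>Q\<close>.\<close>
  have "coin_mean p U (\<lambda>H. Q H * P (F H) / ?m H) = (\<Sum>H\<in>Pow U. Q H * P (F H))"
    unfolding coin_mean_def using mpos
    by (intro sum.cong refl nonzero_mult_div_cancel_left[of _ "_ :: real", folded times_divide_eq_right]) (metis less_irrefl)
  also have "\<dots> = (\<Sum>x\<in>F ` Pow U. \<Sum>H\<in>{H\<in>Pow U. F H = x}. Q H * P (F H))"
    using assms(1) by (subst sum.group) auto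
  also have "\<dots> = (\<Sum>x\<in>F ` Pow U. (\<Sum>H\<in>{H\<in>Pow U. F H = x}. Q H) * P x)"
    unfolding sum_distrib_right by (intro sum.cong refl) auto
  also have "\<dots> \<le> (\<Sum>x\<in>F ` Pow U. 1 * P x)"
    using Ppos by (intro sum_mono mult_right_mono le) (auto intro: less_imp_le)
  finally have "coin_mean p U (\<lambda>H. ln (Q H * P (F H) / ?m H)) \<le> 0"
    using assms Ppos mpos Psum by (intro coin_mean_ln_le) auto
  moreover have "coin_mean p U (\<lambda>H. ln (Q H * P (F H) / ?m H)) =
      coin_mean p U (\<lambda>H. (- ln (?m H) - (- ln (P (F H)))) - (- ln (Q H)))"
  proof (intro coin_mean_cong)
    fix H assume "H \<subseteq> U"
    then show "ln (Q H * P (F H) / ?m H) = (- ln (?m H) - (- ln (P (F H)))) - (- ln (Q H))"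
      using pos[of H] Ppos[of H] ln_div[of "Q H * P (F H)" "?m H"] ln_mult[of "Q H" "P (F H)"] mpos[of H] assms(2,3)
      by simp
  qed
  moreover have "coin_entropy p U (\<lambda>H. H) = coin_mean p U (\<lambda>H. - ln (?m H))"
    unfolding coin_entropy_def using assms(1) by (intro coin_mean_cong) (simp add: coin_prob_eq)
  ultimately show ?thesis
    unfolding coin_mean_diff by (simp add: coin_entropy_def P_def)
qed

lemma ln_bernoulli_weight:
  "0 < (s::real) \<Longrightarrow> s < 1 \<Longrightarrow> - ln (s ^ a * (1 - s) ^ b) = real a * ln (1 / s) + real b * ln (1 / (1 - s))"
  by (simp add: ln_mult ln_realpow ln_div)

lemma coin_entropy_id:
  assumes "finite U" "0 < p" "p < 1"
  shows "coin_entropy p U (\<lambda>H. H) = real (card U) * (p * ln (1 / p) + (1 - p) * ln (1 / (1 - p)))"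
proof -
  have "coin_entropy p U (\<lambda>H. H) =
      coin_mean p U (\<lambda>H. real (card H) * ln (1 / p) + (real (card U) - real (card H)) * ln (1 / (1 - p)))"
    unfolding coin_entropy_def
  proof (intro coin_mean_cong)
    fix H assume H: "H \<subseteq> U"
    then have "real (card (U - H)) = real (card U) - real (card H)"
      using assms(1) by (simp add: card_Diff_subset finite_subset card_mono of_nat_diff)
    then show "- ln (coin_prob p U (\<lambda>H'. H' = H)) =
        real (card H) * ln (1 / p) + (real (card U) - real (card H)) * ln (1 / (1 - p))"
      using ln_bernoulli_weight[OF assms(2,3), of "card H" "card (U - H)"] assms(1) H
      by (simp add: coin_prob_eq)
  qed
  then show ?thesis
    using assms(1) by (simp add: coin_mean_add coin_mean_cmult coin_mean_diff coin_mean_card algebra_simps)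
qed

text \<open>The comparison model is the random subset of \<open>V\<close> of density
  \<open>q\<close>. The number of absent elements is simply bounded by \<open>card V\<close>, which
  is cheap for small \<open>q\<close>.\<close>

lemma coin_entropy_set_le:
  assumes "finite U" "0 < p" "p < 1" "0 < q" "q < 1" "finite V"
    and F: "\<And>H. H \<subseteq> U \<Longrightarrow> F H \<subseteq> V"
  shows "coin_entropy p U F \<le> coin_mean p U (\<lambda>H. real (card (F H))) * ln (1 / q) +
    real (card V) * ln (1 / (1 - q))"
proof -
  let ?Q = "\<lambda>G. q ^ card G * (1 - q) ^ card (V - G)"
  have "(\<Sum>x\<in>F ` Pow U. ?Q x) \<le> (\<Sum>x\<in>Pow V. ?Q x)"
    using F assms by (intro sum_mono2) auto
  also have "\<dots> = coin_mean q V (\<lambda>_. 1)" by (simp add: coin_mean_def)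
  finally have "coin_entropy p U F \<le> coin_mean p U (\<lambda>H. - ln (?Q (F H)))"
    using assms by (intro coin_entropy_le) auto
  also have "\<dots> \<le> coin_mean p U (\<lambda>H. real (card (F H)) * ln (1 / q) + real (card V) * ln (1 / (1 - q)))"
    using assms unfolding ln_bernoulli_weight[OF assms(4,5)]
    by (intro coin_mean_mono add_left_mono mult_right_mono) (auto intro!: card_mono)
  finally show ?thesis using assms(1) by (simp add: coin_mean_add coin_mean_cmult)
qed

text \<open>\<open>K x\<close> is a set of candidates determined by the value \<open>x\<close> and
  containing every compatible \<open>H\<close>. The model keeps each candidate with probability
  \<open>s\<close>: a kept one costs \<open>ln (1 / s)\<close>, a rejected one
  \<open>ln (1 / (1 - s))\<close>.\<close>

lemma coin_entropy_diff_set_le: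
  assumes "finite U" "0 < p" "p < 1" "0 < s" "s < 1"
    and K: "\<And>x. finite (K x)" "\<And>H. H \<subseteq> U \<Longrightarrow> H \<subseteq> K (F H)"
  shows "coin_entropy p U (\<lambda>H. H) - coin_entropy p U F \<le>
    real (card U) * p * ln (1 / s) + coin_mean p U (\<lambda>H. real (card (K (F H) - H))) * ln (1 / (1 - s))"
proof -
  let ?Q = "\<lambda>H. s ^ card H * (1 - s) ^ card (K (F H) - H)"
  have "coin_entropy p U (\<lambda>H. H) - coin_entropy p U F \<le> coin_mean p U (\<lambda>H. - ln (?Q H))"
  proof (intro coin_entropy_diff_le)
    fix x
    \<comment> \<open>The fibre over \<open>x\<close> consists of subsets of \<open>K x\<close>, and
      the weights of all subsets of \<open>K x\<close> add up to 1.\<close>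
    have "(\<Sum>H\<in>{H\<in>Pow U. F H = x}. ?Q H) = (\<Sum>H\<in>{H\<in>Pow U. F H = x}. s ^ card H * (1 - s) ^ card (K x - H))"
      by (intro sum.cong) auto
    also have "\<dots> \<le> (\<Sum>H\<in>Pow (K x). s ^ card H * (1 - s) ^ card (K x - H))"
      using K assms by (intro sum_mono2) auto
    also have "\<dots> = coin_mean s (K x) (\<lambda>_. 1)" by (simp add: coin_mean_def)
    finally show "(\<Sum>H\<in>{H\<in>Pow U. F H = x}. ?Q H) \<le> 1" using K by simp
  qed (use assms in auto)
  also have "\<dots> = real (card U) * p * ln (1 / s) + coin_mean p U (\<lambda>H. real (card (K (F H) - H))) * ln (1 / (1 - s))"
    unfolding ln_bernoulli_weight[OF assms(4,5)]
    using assms(1) by (simp add: coin_mean_add coin_mean_cmult coin_mean_card)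
  finally show ?thesis .
qed

section \<open>Covering pairs by hyperedges\<close>

definition pairs :: "'a set \<Rightarrow> 'a set set" where
  "pairs h = {s. s \<subseteq> h \<and> card s = 2}"

definition covers :: "'a set set \<Rightarrow> 'a set set \<Rightarrow> bool" where
  "covers H S \<longleftrightarrow> S \<subseteq> \<Union> (pairs ` H)"

lemma finite_pairs [simp]: "finite h \<Longrightarrow> finite (pairs h)"
  unfolding pairs_def by (rule finite_subset[of _ "Pow h"]) auto

lemma card_pairs: "finite h \<Longrightarrow> card (pairs h) = card h choose 2"
  unfolding pairs_def by (rule n_subsets)

lemma pairs_Int: "pairs (g \<inter> h) = pairs g \<inter> pairs h"
  by (auto simp: pairs_def)

lemma Proj_eq:
  assumes "H \<subseteq> d_subsets d n"
  shows "Proj n H = \<Union> (pairs ` H)"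
proof
  show "Proj n H \<subseteq> \<Union> (pairs ` H)"
    by (force simp: Proj_def pairs_def)
  show "\<Union> (pairs ` H) \<subseteq> Proj n H"
  proof
    fix s assume "s \<in> \<Union> (pairs ` H)"
    then obtain h where h: "h \<in> H" "s \<subseteq> h" "card s = 2" by (auto simp: pairs_def)
    then obtain i j where "s = {i, j}" "i \<noteq> j" by (auto simp: card_2_iff)
    moreover have "h \<subseteq> {1..n}" using h assms by (auto simp: d_subsets_def)
    ultimately show "s \<in> Proj n H" using h unfolding Proj_def by blast
  qed
qed

lemma Proj_subset: "H \<subseteq> d_subsets d n \<Longrightarrow> Proj n H \<subseteq> pairs {1..n}"
  by (auto simp: Proj_def pairs_def)

lemma card_d_subsets_superset:
  assumes "A \<subseteq> {1..n}" "card A \<le> d"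
  shows "card {e \<in> d_subsets d n. A \<subseteq> e} = (n - card A) choose (d - card A)"
proof -
  have finA: "finite A" using assms(1) finite_subset by blast
  have "bij_betw (\<lambda>e. e - A) {e \<in> d_subsets d n. A \<subseteq> e} {B. B \<subseteq> {1..n} - A \<and> card B = d - card A}"
  proof (rule bij_betwI[where g = "\<lambda>B. B \<union> A"])
    show "(\<lambda>e. e - A) \<in> {e \<in> d_subsets d n. A \<subseteq> e} \<rightarrow> {B. B \<subseteq> {1..n} - A \<and> card B = d - card A}"
      using finA by (auto simp: d_subsets_def card_Diff_subset)
    show "(\<lambda>B. B \<union> A) \<in> {B. B \<subseteq> {1..n} - A \<and> card B = d - card A} \<rightarrow> {e \<in> d_subsets d n. A \<subseteq> e}"
    proof
      fix B assume "B \<in> {B. B \<subseteq> {1..n} - A \<and> card B = d - card A}"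
      then have B: "B \<subseteq> {1..n} - A" "card B = d - card A" by auto
      then have "finite B" by (meson finite_Diff finite_atLeastAtMost finite_subset)
      then have "card (B \<union> A) = d"
        using B finA assms by (subst card_Un_disjoint) auto
      then show "B \<union> A \<in> {e \<in> d_subsets d n. A \<subseteq> e}"
        using B assms by (auto simp: d_subsets_def)
    qed
  qed (auto simp: d_subsets_def)
  then have "card {e \<in> d_subsets d n. A \<subseteq> e} = card {B. B \<subseteq> {1..n} - A \<and> card B = d - card A}"
    by (rule bij_betw_same_card)
  also have "\<dots> = (n - card A) choose (d - card A)"
    using assms finA by (subst n_subsets) (auto simp: card_Diff_subset)
  finally show ?thesis .
qed

lemma choose_le_pow: "n choose k \<le> n ^ k"
  by (cases "k \<le> n") (auto simp: binomial_le_pow binomial_eq_0)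

text \<open>Once \<open>e\<close> has covered \<open>s\<close>, the pairs outside \<open>e\<close> must be covered by the other hyperedges,
  so the two events on the right are independent.\<close>

lemma coin_prob_covers_step:
  assumes "finite U" "0 \<le> p" "p \<le> 1" "s \<in> S"
  shows "coin_prob p U (\<lambda>H. covers H S) \<le>
    (\<Sum>e\<in>{e\<in>U. s \<in> pairs e}. p * coin_prob p U (\<lambda>H. covers H (S - pairs e)))"
proof -
  have "coin_prob p U (\<lambda>H. covers H S) \<le>
      coin_mean p U (\<lambda>H. \<Sum>e\<in>{e\<in>U. s \<in> pairs e}. of_bool (e \<in> H) * of_bool (covers H (S - pairs e)))"
    unfolding coin_prob_def
  proof (intro coin_mean_mono assms)
    fix H assume H: "H \<subseteq> U"
    show "of_bool (covers H S) \<le>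
        (\<Sum>e\<in>{e\<in>U. s \<in> pairs e}. of_bool (e \<in> H) * (of_bool (covers H (S - pairs e)) :: real))"
    proof (cases "covers H S")
      case True
      then obtain e where e: "e \<in> H" "s \<in> pairs e" using assms(4) by (auto simp: covers_def)
      have "covers H (S - pairs e)" using True by (auto simp: covers_def)
      then have "of_bool (covers H S) = of_bool (e \<in> H) * (of_bool (covers H (S - pairs e)) :: real)"
        using True e by simp
      also have "\<dots> \<le> (\<Sum>e\<in>{e\<in>U. s \<in> pairs e}. of_bool (e \<in> H) * (of_bool (covers H (S - pairs e)) :: real))"
        using assms(1) e H by (intro member_le_sum) auto
      finally show ?thesis .
    qed (auto intro!: sum_nonneg)
  qed
  also have "\<dots> = (\<Sum>e\<in>{e\<in>U. s \<in> pairs e}. p * coin_prob p U (\<lambda>H. covers H (S - pairs e)))"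
    unfolding coin_mean_sum
  proof (intro sum.cong refl)
    fix e assume "e \<in> {e\<in>U. s \<in> pairs e}"
    then have e: "e \<in> U" by simp
    let ?f = "\<lambda>H. of_bool (covers H (S - pairs e)) :: real"
    have indep: "?f (insert e H) = ?f H" for H
      by (auto simp: covers_def)
    show "coin_mean p U (\<lambda>H. of_bool (e \<in> H) * of_bool (covers H (S - pairs e))) =
        p * coin_prob p U (\<lambda>H. covers H (S - pairs e))"
      unfolding coin_prob_def coin_mean_indep(2)[where f = ?f, OF assms(1) e indep]
        coin_mean_indep(1)[where f = ?f, OF assms(1) e indep] ..
  qed
  finally show ?thesis .
qed

lemma finite_pairs_subset: "S \<subseteq> pairs h \<Longrightarrow> finite h \<Longrightarrow> finite S"
  using finite_subset finite_pairs by blast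

lemma card_d_subsets_pair:
  assumes "s \<in> pairs {1..n}" "2 \<le> d"
  shows "card {e \<in> d_subsets d n. s \<in> pairs e} = (n - 2) choose (d - 2)"
proof -
  have "{e \<in> d_subsets d n. s \<in> pairs e} = {e \<in> d_subsets d n. s \<subseteq> e}"
    using assms by (auto simp: pairs_def)
  then show ?thesis
    using card_d_subsets_superset[of s n d] assms by (simp add: pairs_def)
qed

text \<open>Induction on \<open>card S\<close> with the covering step at a fixed pair
  \<open>s\<close>: the hyperedges through \<open>s\<close> have total weight \<open>q\<close>, and
  this factor pays for lowering the exponent by one.\<close>

lemma coin_prob_covers_le:
  assumes "2 \<le> d" "0 < p" "p \<le> 1" and q: "q = real ((n - 2) choose (d - 2)) * p" "0 < q" "q \<le> 1"
    and "S \<subseteq> pairs {1..n}"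
  shows "coin_prob p (d_subsets d n) (\<lambda>H. covers H S) \<le> q powr (real (card S) / real (d choose 2))"
  using \<open>S \<subseteq> pairs {1..n}\<close>
proof (induction "card S" arbitrary: S rule: less_induct)
  case less
  let ?D = "real (d choose 2)" and ?P = "\<lambda>S. coin_prob p (d_subsets d n) (\<lambda>H. covers H S)"
  have D: "?D > 0" using assms(1) by simp
  have fin: "finite S" using less.prems by (rule finite_pairs_subset) simp
  show ?case
  proof (cases "S = {}")
    case True
    then show ?thesis using coin_prob_le_1[of "d_subsets d n" p] assms(2,3) q(2) by simp
  next
    case False
    then obtain s where s: "s \<in> S" by auto
    have "?P (S - pairs e) \<le> q powr (real (card S) / ?D - 1)"
      if e: "e \<in> d_subsets d n" "s \<in> pairs e" for e
    proof -
      have fe: "finite e" "card e = d"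
        using e finite_subset[of e "{1..n}"] by (auto simp: d_subsets_def)
      have "card (S - pairs e) < card S"
        using s e fin by (intro psubset_card_mono) auto
      then have "?P (S - pairs e) \<le> q powr (real (card (S - pairs e)) / ?D)"
        using less.prems by (intro less.hyps) auto
      \<comment> \<open>One hyperedge covers at most \<open>?D\<close> pairs, and
        \<open>q \<le> 1\<close> makes the power decreasing in its exponent.\<close>
      also have "\<dots> \<le> q powr (real (card S) / ?D - 1)"
      proof (intro powr_mono')
        have "card S \<le> card ((S - pairs e) \<union> pairs e)"
          using fin fe by (intro card_mono) auto
        also have "\<dots> \<le> card (S - pairs e) + card (pairs e)"
          by (rule card_Un_le)
        finally have "card S \<le> card (S - pairs e) + card (pairs e)" .
        then have "real (card S) \<le> real (card (S - pairs e)) + ?D"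
          using fe by (simp add: card_pairs flip: of_nat_add)
        then have "real (card S) / ?D \<le> (real (card (S - pairs e)) + ?D) / ?D"
          using D by (intro divide_right_mono) auto
        moreover have "(real (card (S - pairs e)) + ?D) / ?D = real (card (S - pairs e)) / ?D + 1"
          using D by (simp add: add_divide_distrib)
        ultimately show "real (card S) / ?D - 1 \<le> real (card (S - pairs e)) / ?D"
          by linarith
      qed (use q in auto)
      finally show ?thesis .
    qed
    then have "(\<Sum>e\<in>{e\<in>d_subsets d n. s \<in> pairs e}. p * ?P (S - pairs e)) \<le>
        (\<Sum>e\<in>{e\<in>d_subsets d n. s \<in> pairs e}. p * q powr (real (card S) / ?D - 1))"
      using assms by (intro sum_mono mult_left_mono) auto
    also have "\<dots> = q * q powr (real (card S) / ?D - 1)"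
      using card_d_subsets_pair[of s n d] s less.prems assms(1) by (auto simp: q(1))
    also have "\<dots> = q powr (real (card S) / ?D)"
      using q(2) by (simp add: powr_diff)
    finally show ?thesis
      using coin_prob_covers_step[of "d_subsets d n" p s S] s assms by simp
  qed
qed

section \<open>Edge count and entropy of the projected graph\<close>

lemma coin_mean_card_Proj:
  "coin_mean p (d_subsets d n) (\<lambda>H. real (card (Proj n H))) =
    (\<Sum>s\<in>pairs {1..n}. coin_prob p (d_subsets d n) (\<lambda>H. s \<in> Proj n H))"
  by (intro coin_mean_card_set Proj_subset) auto

text \<open>The union bound over the hyperedges through a pair, read off from the covering step with
  \<open>S = {s}\<close>.\<close>

lemma coin_mean_card_Proj_le:
  assumes "2 \<le> d" "0 \<le> p" "p \<le> 1"
  shows "coin_mean p (d_subsets d n) (\<lambda>H. real (card (Proj n H))) \<le>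
    real (n choose 2) * (real ((n - 2) choose (d - 2)) * p)"
proof -
  have "coin_prob p (d_subsets d n) (\<lambda>H. s \<in> Proj n H) \<le> real ((n - 2) choose (d - 2)) * p"
    if s: "s \<in> pairs {1..n}" for s
  proof -
    have "coin_prob p (d_subsets d n) (\<lambda>H. s \<in> Proj n H) \<le> coin_prob p (d_subsets d n) (\<lambda>H. covers H {s})"
      using assms by (intro coin_prob_mono) (auto simp: Proj_eq covers_def)
    also have "\<dots> \<le> (\<Sum>e\<in>{e\<in>d_subsets d n. s \<in> pairs e}. p * coin_prob p (d_subsets d n) (\<lambda>H. covers H ({s} - pairs e)))"
      using assms by (intro coin_prob_covers_step) auto
    also have "\<dots> \<le> (\<Sum>e\<in>{e\<in>d_subsets d n. s \<in> pairs e}. p * 1)"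
      using assms by (intro sum_mono mult_left_mono coin_prob_le_1) auto
    finally show ?thesis using card_d_subsets_pair[OF s assms(1)] by simp
  qed
  then have "coin_mean p (d_subsets d n) (\<lambda>H. real (card (Proj n H))) \<le>
      (\<Sum>s\<in>pairs {1..n}. real ((n - 2) choose (d - 2)) * p)"
    unfolding coin_mean_card_Proj by (rule sum_mono)
  then show ?thesis by (simp add: card_pairs)
qed

text \<open>Used to show that the union bound for covering a pair loses at most a factor 2. The
  chain passes through \<open>exp (- k p) \<le> 1 / (1 + k p)\<close>.\<close>

lemma one_minus_power_le:
  fixes p :: real
  assumes "0 \<le> p" "p \<le> 1" "real k * p \<le> 1"
  shows "(1 - p) ^ k \<le> 1 - real k * p / 2"
proof -
  let ?x = "real k * p"
  have x: "0 \<le> ?x" using assms by simp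
  have "(1 - p) ^ k \<le> exp (- p) ^ k"
    using assms exp_ge_add_one_self[of "- p"] by (intro power_mono) auto
  also have "\<dots> = 1 / exp ?x" by (simp add: exp_of_nat_mult exp_minus inverse_eq_divide power_one_over)
  also have "\<dots> \<le> 1 / (1 + ?x)"
    using x exp_ge_add_one_self[of ?x] by (intro divide_left_mono) (auto intro!: mult_pos_pos)
  also have "\<dots> \<le> 1 - ?x / 2"
  proof -
    have "?x * ?x \<le> ?x * 1" using x assms(3) by (intro mult_left_mono)
    then have "1 \<le> (1 - ?x / 2) * (1 + ?x)" by (simp add: algebra_simps)
    then show ?thesis using x by (subst pos_divide_le_eq) auto
  qed
  finally show ?thesis .
qed

lemma coin_mean_card_Proj_ge:
  assumes "2 \<le> d" "0 \<le> p" "p \<le> 1" "real ((n - 2) choose (d - 2)) * p \<le> 1"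
  shows "real (n choose 2) * (real ((n - 2) choose (d - 2)) * p) / 2 \<le>
    coin_mean p (d_subsets d n) (\<lambda>H. real (card (Proj n H)))"
proof -
  have "real ((n - 2) choose (d - 2)) * p / 2 \<le> coin_prob p (d_subsets d n) (\<lambda>H. s \<in> Proj n H)"
    if s: "s \<in> pairs {1..n}" for s
  proof -
    let ?V = "{e\<in>d_subsets d n. s \<in> pairs e}"
    have "coin_prob p (d_subsets d n) (\<lambda>H. s \<in> Proj n H) =
        coin_mean p (d_subsets d n) (\<lambda>H. 1 - of_bool (H \<inter> ?V = {}))"
      unfolding coin_prob_def by (intro coin_mean_cong) (auto simp: Proj_eq)
    also have "\<dots> = 1 - (1 - p) ^ card ?V"
      using coin_prob_disjoint[of "d_subsets d n" ?V p] by (simp add: coin_mean_diff coin_prob_def)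
    finally show ?thesis
      using one_minus_power_le[OF assms(2-4)] card_d_subsets_pair[OF s assms(1)] by simp
  qed
  then have "(\<Sum>s\<in>pairs {1..n}. real ((n - 2) choose (d - 2)) * p / 2) \<le>
      coin_mean p (d_subsets d n) (\<lambda>H. real (card (Proj n H)))"
    unfolding coin_mean_card_Proj by (rule sum_mono)
  then show ?thesis by (simp add: card_pairs)
qed

text \<open>If the projection equals \<open>G\<close>, then \<open>G\<close> is covered, so
  \<open>coin_prob_covers_le\<close> bounds the surprisal of \<open>G\<close> below by a multiple of
  \<open>card G\<close>. Averaging brings in the expected edge count.\<close>

lemma coin_entropy_Proj_ge:
  assumes "2 \<le> d" "0 < p" "p < 1" and q: "q = real ((n - 2) choose (d - 2)) * p" "0 < q" "q \<le> 1"
  shows "real (n choose 2) * q / 2 * ln (1 / q) / real (d choose 2) \<le> coin_entropy p (d_subsets d n) (Proj n)"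
proof -
  let ?U = "d_subsets d n" and ?D = "real (d choose 2)"
  have "real (n choose 2) * q / 2 * (ln (1 / q) / ?D) \<le>
      coin_mean p ?U (\<lambda>H. real (card (Proj n H))) * (ln (1 / q) / ?D)"
    using coin_mean_card_Proj_ge[of d p n] assms by (intro mult_right_mono) auto
  also have "\<dots> = coin_mean p ?U (\<lambda>H. real (card (Proj n H)) * (ln (1 / q) / ?D))"
    by (simp only: coin_mean_cmult)
  also have "\<dots> \<le> coin_entropy p ?U (Proj n)"
    unfolding coin_entropy_def
  proof (intro coin_mean_mono)
    fix H assume H: "H \<subseteq> ?U"
    let ?P = "coin_prob p ?U (\<lambda>H'. Proj n H' = Proj n H)"
    have pos: "0 < ?P" using assms H by (intro coin_prob_pos[of _ _ H]) auto
    have "?P \<le> coin_prob p ?U (\<lambda>H'. covers H' (Proj n H))"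
      using assms by (intro coin_prob_mono) (auto simp: covers_def Proj_eq)
    also have "\<dots> \<le> q powr (real (card (Proj n H)) / ?D)"
      using assms H by (intro coin_prob_covers_le Proj_subset) auto
    finally have "ln ?P \<le> ln (q powr (real (card (Proj n H)) / ?D))"
      using pos by (intro ln_mono) auto
    then show "real (card (Proj n H)) * (ln (1 / q) / ?D) \<le> - ln ?P"
      using q(2) by (simp add: ln_powr ln_div)
  qed (use assms in auto)
  finally show ?thesis by simp
qed

text \<open>In the comparison with edge density \<open>q\<close>, a present edge costs
  \<open>ln (1 / q)\<close>; an absent one costs at most \<open>2 * q\<close> because
  \<open>q \<le> 1 / 2\<close>.\<close>

lemma coin_entropy_Proj_le:
  assumes "2 \<le> d" "0 < p" "p < 1" and q: "q = real ((n - 2) choose (d - 2)) * p" "0 < q" "q \<le> 1 / 2"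
  shows "coin_entropy p (d_subsets d n) (Proj n) \<le> real (n choose 2) * q * (ln (1 / q) + 2)"
proof -
  have "coin_entropy p (d_subsets d n) (Proj n) \<le>
      coin_mean p (d_subsets d n) (\<lambda>H. real (card (Proj n H))) * ln (1 / q) +
      real (card (pairs {1..n})) * ln (1 / (1 - q))"
    using assms by (intro coin_entropy_set_le Proj_subset) auto
  also have "\<dots> \<le> (real (n choose 2) * q) * ln (1 / q) + real (n choose 2) * (2 * q)"
  proof (intro add_mono mult_mono mult_right_mono)
    show "coin_mean p (d_subsets d n) (\<lambda>H. real (card (Proj n H))) \<le> real (n choose 2) * q"
      using coin_mean_card_Proj_le[of d p n] assms by simp
    have "ln (1 / (1 - q)) \<le> 1 / (1 - q) - 1" using q by (intro ln_le_minus_one) auto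
    also have "\<dots> = q / (1 - q)" using q by (simp add: field_simps)
    also have "\<dots> \<le> q / (1 / 2)" using q by (intro divide_left_mono) auto
    finally show "ln (1 / (1 - q)) \<le> 2 * q" by simp
  qed (use q in \<open>auto simp: card_pairs\<close>)
  finally show ?thesis by (simp add: algebra_simps)
qed

section \<open>Cliques covered by other hyperedges\<close>

lemma of_nat_choose_two: "real (a choose 2) = real a * (real a - 1) / 2"
  by (induction a) (auto simp: numeral_2_eq_2 field_simps)

text \<open>A hyperedge meeting a fixed \<open>d\<close>-set in \<open>a\<close> vertices covers \<open>a choose 2\<close> of its pairs at cost
  \<open>n\<close> to the power \<open>a - 1 - \<delta>\<close>.  At the critical \<open>\<delta>\<close> the cost per pair is smallest
  for \<open>a = 2\<close> and \<open>a = d\<close>.\<close>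

lemma cover_cost:
  assumes "2 \<le> a" "a \<le> d"
  shows "2 / (real d + 1) * real (a choose 2) \<le> real a - 1 - (real d - 1) / (real d + 1)"
proof -
  have "real a - 1 - (real d - 1) / (real d + 1) - 2 / (real d + 1) * real (a choose 2) =
      (real a - 2) * (real d - real a) / (real d + 1)"
    unfolding of_nat_choose_two by (simp add: divide_simps) (simp add: algebra_simps)
  moreover have "0 \<le> (real a - 2) * (real d - real a) / (real d + 1)"
    using assms by simp
  ultimately show ?thesis by linarith
qed

section \<open>Covering the pairs of a fixed \<open>d\<close>-set \<open>e0\<close> by other
  hyperedges\<close>

context
  fixes d n :: nat and p \<alpha> \<delta> \<eta> :: real and e0 :: "nat set"
  assumes n: "1 \<le> n" and p: "0 \<le> p" "p \<le> 1" "p \<le> \<alpha> * real n powr (- real d + 1 + \<delta>)" and \<alpha>: "0 \<le> \<alpha>"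
    and \<eta>: "\<eta> = (real d - 1) / (real d + 1) - \<delta>" and e0: "e0 \<in> d_subsets d n"
begin

text \<open>Removing \<open>e0\<close> from the ground set isolates the chance that its pairs are
  covered without it.\<close>

private definition R :: "nat set set \<Rightarrow> real" where
  "R S = coin_prob p (d_subsets d n - {e0}) (\<lambda>H. covers H S)"

private lemma e0_finite: "finite e0" "card e0 = d" "e0 \<subseteq> {1..n}"
  using e0 finite_subset[of e0 "{1..n}"] by (auto simp: d_subsets_def)

text \<open>Sort the hyperedges through \<open>s\<close> by their trace \<open>A\<close> on
  \<open>e0\<close>, of size \<open>a\<close>. There are at most \<open>n ^ (d - a)\<close> of them
  per trace, and at most \<open>2 ^ d\<close> traces. By \<open>cover_cost\<close> each step pays
  for the pairs it covers with a surplus factor \<open>n powr (- \<eta>)\<close>;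
  \<open>\<theta>\<close> carries the surplus of earlier steps along.\<close>

private lemma cover_others_step:
  assumes S: "S \<subseteq> pairs e0" "s \<in> S" and B: "0 \<le> B"
    and bound: "\<And>A. A \<subset> e0 \<Longrightarrow> s \<in> pairs A \<Longrightarrow>
      R (S - pairs A) \<le> B * real n powr (- (2 / (real d + 1)) * real (card (S - pairs A)) - \<theta>)"
  shows "R S \<le> 2 ^ d * \<alpha> * B * real n powr (- (2 / (real d + 1)) * real (card S) - \<eta> - \<theta>)"
proof -
  define l where "l = 2 / (real d + 1)"
  define c where "c = B * (\<alpha> * real n powr (- l * real (card S) - \<eta> - \<theta>))"
  have l: "0 \<le> l" by (simp add: l_def)
  have fin: "finite S" using S e0_finite finite_pairs_subset by blast
  let ?U = "d_subsets d n - {e0}"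
  let ?E = "{e\<in>?U. s \<in> pairs e}" and ?As = "{A. A \<subset> e0 \<and> s \<in> pairs A}"
  have finAs: "finite ?As" using e0_finite by (auto intro: finite_subset[of _ "Pow e0"])
  \<comment> \<open>A hyperedge other than \<open>e0\<close> has the same size, so it cannot contain
    \<open>e0\<close> and its trace is proper.\<close>
  have "e \<inter> e0 \<in> ?As" if "e \<in> ?E" for e
  proof -
    have "\<not> e0 \<subseteq> e"
      using that e0_finite card_subset_eq[of e e0] finite_subset[of e "{1..n}"]
      by (auto simp: d_subsets_def)
    then show ?thesis using that S by (auto simp: pairs_Int)
  qed
  then have img: "(\<lambda>e. e \<inter> e0) ` ?E \<subseteq> ?As" by auto
  have A_bound: "(\<Sum>e\<in>{e\<in>?E. e \<inter> e0 = A}. p * R (S - pairs e)) \<le> c" if A: "A \<in> ?As" for A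
  proof -
    define a where "a = card A"
    have finA: "finite A" using A e0_finite finite_subset by blast
    have a: "2 \<le> a" "a \<le> d" "A \<subseteq> {1..n}"
      using A e0_finite finA card_mono[of A s] psubset_card_mono[of e0 A]
      by (auto simp: a_def pairs_def)
    \<comment> \<open>\<open>S\<close> consists of pairs inside \<open>e0\<close>, so only the trace
      of \<open>e\<close> matters.\<close>
    have R_eq: "R (S - pairs e) = R (S - pairs A)" if "e \<inter> e0 = A" for e
      using S that pairs_Int[of e e0] by (intro arg_cong[where f = R]) auto
    have "card S \<le> card ((S - pairs A) \<union> pairs A)"
      using fin finA by (intro card_mono) auto
    also have "\<dots> \<le> card (S - pairs A) + (a choose 2)"
      using card_Un_le[of "S - pairs A" "pairs A"] finA by (simp add: card_pairs a_def)
    finally have "real (card S) \<le> real (card (S - pairs A)) + real (a choose 2)"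
      unfolding of_nat_add[symmetric] by (rule of_nat_mono)
    then have "l * real (card S) \<le> l * (real (card (S - pairs A)) + real (a choose 2))"
      using l by (intro mult_left_mono)
    \<comment> \<open>The three summands on the left come from the number of hyperedges with trace
      \<open>A\<close>, from \<open>p\<close>, and from the pairs still to be covered.\<close>
    then have exponent: "(real d - real a) + (- real d + 1 + \<delta>) + (- l * real (card (S - pairs A)) - \<theta>) \<le>
        - l * real (card S) - \<eta> - \<theta>"
      using cover_cost[OF a(1,2), folded l_def] by (simp add: distrib_left \<eta>)
    have "R (S - pairs A) \<le> B * real n powr (- l * real (card (S - pairs A)) - \<theta>)"
      using bound A by (simp add: l_def)
    then have pR: "p * R (S - pairs A) \<le>
        (\<alpha> * real n powr (- real d + 1 + \<delta>)) * (B * real n powr (- l * real (card (S - pairs A)) - \<theta>))"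
      unfolding R_def using p \<alpha> B by (intro mult_mono coin_prob_nonneg) auto
    have "card {e\<in>?E. e \<inter> e0 = A} \<le> card {e \<in> d_subsets d n. A \<subseteq> e}"
      by (intro card_mono) auto
    also have "\<dots> \<le> (n - a) ^ (d - a)"
      using a choose_le_pow card_d_subsets_superset[of A n d] by (simp add: a_def)
    also have "\<dots> \<le> n ^ (d - a)" by (intro power_mono) auto
    finally have "real (card {e\<in>?E. e \<inter> e0 = A}) \<le> real n ^ (d - a)"
      unfolding of_nat_power[symmetric] by (rule of_nat_mono)
    also have "\<dots> = real n powr (real d - real a)"
      using n a by (simp add: powr_realpow[symmetric] of_nat_diff)
    finally have card_E: "real (card {e\<in>?E. e \<inter> e0 = A}) \<le> real n powr (real d - real a)" .
    have "(\<Sum>e\<in>{e\<in>?E. e \<inter> e0 = A}. p * R (S - pairs e)) = real (card {e\<in>?E. e \<inter> e0 = A}) * (p * R (S - pairs A))"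
      unfolding sum_constant[symmetric] using R_eq by (intro sum.cong refl) auto
    also have "\<dots> \<le> real n powr (real d - real a) *
        ((\<alpha> * real n powr (- real d + 1 + \<delta>)) * (B * real n powr (- l * real (card (S - pairs A)) - \<theta>)))"
      using p unfolding R_def
      by (intro mult_mono card_E pR[unfolded R_def] mult_nonneg_nonneg coin_prob_nonneg) auto
    also have "\<dots> = B * (\<alpha> * real n powr ((real d - real a) + (- real d + 1 + \<delta>) + (- l * real (card (S - pairs A)) - \<theta>)))"
      by (simp only: powr_add mult_ac)
    also have "\<dots> \<le> c"
      unfolding c_def using n \<alpha> B exponent by (intro mult_left_mono powr_mono) auto
    finally show ?thesis .
  qed
  have "R S \<le> (\<Sum>e\<in>?E. p * R (S - pairs e))"
    unfolding R_def using p S by (intro coin_prob_covers_step) auto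
  also have "\<dots> = (\<Sum>A\<in>?As. \<Sum>e\<in>{e\<in>?E. e \<inter> e0 = A}. p * R (S - pairs e))"
    using finAs img by (intro sum.group[symmetric]) auto
  also have "\<dots> \<le> (\<Sum>A\<in>?As. c)" by (intro sum_mono A_bound)
  also have "\<dots> = real (card ?As) * c" by simp
  also have "\<dots> \<le> 2 ^ d * c"
  proof (intro mult_right_mono)
    have "card ?As \<le> card (Pow e0)" using e0_finite by (intro card_mono) auto
    then show "real (card ?As) \<le> 2 ^ d" using e0_finite by (simp add: card_Pow numeral_power_le_of_nat_cancel_iff)
  qed (use \<alpha> B in \<open>auto simp: c_def\<close>)
  finally show ?thesis by (simp add: c_def l_def mult_ac)
qed

text \<open>The bound without any surplus, by iterating the step. The summand 1 in the constant
  makes its powers increasing, so bounds for smaller sets can be enlarged to a common one.\<close>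

private lemma cover_others_le:
  assumes "S \<subseteq> pairs e0" "0 \<le> \<eta>"
  shows "R S \<le> (1 + 2 ^ d * \<alpha>) ^ card S * real n powr (- (2 / (real d + 1)) * real (card S))"
  using assms(1)
proof (induction "card S" arbitrary: S rule: less_induct)
  case less
  let ?K = "1 + 2 ^ d * \<alpha>" and ?l = "2 / (real d + 1)"
  have K: "1 \<le> ?K" using \<alpha> by simp
  have fin: "finite S" using less.prems e0_finite finite_pairs_subset by blast
  show ?case
  proof (cases "S = {}")
    case True
    then show ?thesis using n p by (simp add: R_def coin_prob_le_1)
  next
    case False
    then obtain s where s: "s \<in> S" by auto
    have "R S \<le> 2 ^ d * \<alpha> * ?K ^ (card S - 1) * real n powr (- ?l * real (card S) - \<eta> - 0)"
    proof (intro cover_others_step[where s = s] less.prems)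
      fix A assume A: "A \<subset> e0" "s \<in> pairs A"
      have lt: "card (S - pairs A) < card S"
        using s A fin by (intro psubset_card_mono) auto
      then have "R (S - pairs A) \<le> ?K ^ card (S - pairs A) * real n powr (- ?l * real (card (S - pairs A)))"
        using less.prems by (intro less.hyps) auto
      also have "\<dots> \<le> ?K ^ (card S - 1) * real n powr (- ?l * real (card (S - pairs A)))"
        using K lt by (intro mult_right_mono power_increasing) auto
      finally show "R (S - pairs A) \<le> ?K ^ (card S - 1) * real n powr (- ?l * real (card (S - pairs A)) - 0)"
        by simp
    qed (use \<alpha> s in auto)
    \<comment> \<open>The surplus of this step is discarded, which is allowed as
      \<open>0 \<le> \<eta>\<close>.\<close>
    also have "\<dots> \<le> ?K * ?K ^ (card S - 1) * real n powr (- ?l * real (card S))"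
      using \<alpha> n assms(2) by (intro mult_mono powr_mono) auto
    also have "?K * ?K ^ (card S - 1) = ?K ^ card S"
      using s fin by (metis card_gt_0_iff empty_iff power_eq_if less_irrefl)
    finally show ?thesis .
  qed
qed

text \<open>Without surplus the bound is \<open>n powr (- d + 1 + \<delta> + \<eta>)\<close>, too
  weak by \<open>n powr \<eta>\<close>. No single other hyperedge covers all pairs of
  \<open>e0\<close>, so at least two steps occur and their two surpluses turn
  \<open>+ \<eta>\<close> into \<open>- \<eta>\<close>. \<open>R1\<close> has no surplus,
  \<open>R2\<close> has one, and the final step adds the second.\<close>

lemma clique_prob_le:
  assumes "2 \<le> d" "0 \<le> \<eta>"
  shows "coin_prob p (d_subsets d n - {e0}) (\<lambda>H. covers H (pairs e0)) \<le>
    (2 ^ d * \<alpha>) ^ 2 * (1 + 2 ^ d * \<alpha>) ^ (d choose 2) * real n powr (- real d + 1 + \<delta> - \<eta>)"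
proof -
  let ?K = "1 + 2 ^ d * \<alpha>" and ?l = "2 / (real d + 1)" and ?D = "d choose 2"
  have K: "1 \<le> ?K" using \<alpha> by simp
  have card_le: "card S \<le> ?D" if "S \<subseteq> pairs e0" for S
    using that card_mono[of "pairs e0" S] e0_finite by (simp add: card_pairs)
  have R1: "R S \<le> ?K ^ ?D * real n powr (- ?l * real (card S) - 0)" if "S \<subseteq> pairs e0" for S
  proof -
    have "R S \<le> ?K ^ card S * real n powr (- ?l * real (card S))"
      by (rule cover_others_le[OF that assms(2)])
    also have "\<dots> \<le> ?K ^ ?D * real n powr (- ?l * real (card S) - 0)"
      using K card_le[OF that] by (auto intro!: mult_right_mono power_increasing)
    finally show ?thesis .
  qed
  have R2: "R S \<le> 2 ^ d * \<alpha> * ?K ^ ?D * real n powr (- ?l * real (card S) - \<eta>)"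
    if S: "S \<subseteq> pairs e0" "S \<noteq> {}" for S
  proof -
    obtain s where "s \<in> S" using S by auto
    then have "R S \<le> 2 ^ d * \<alpha> * ?K ^ ?D * real n powr (- ?l * real (card S) - \<eta> - 0)"
      using S \<alpha> by (intro cover_others_step R1) auto
    then show ?thesis by simp
  qed
  have "card (pairs e0) \<noteq> 0" using e0_finite assms(1) by (simp add: card_pairs)
  then obtain s where s: "s \<in> pairs e0" using card_gt_0_iff by fastforce
  have "R (pairs e0) \<le> 2 ^ d * \<alpha> * (2 ^ d * \<alpha> * ?K ^ ?D) * real n powr (- ?l * real (card (pairs e0)) - \<eta> - \<eta>)"
  proof (intro cover_others_step[where s = s] R2)
    fix A assume A: "A \<subset> e0" "s \<in> pairs A"
    \<comment> \<open>A vertex of \<open>e0\<close> outside the trace together with one inside gives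
      a pair that is still uncovered.\<close>
    then obtain x y where "x \<in> e0" "x \<notin> A" "y \<in> A" by (auto simp: pairs_def card_2_iff)
    then have "{x, y} \<in> pairs e0 - pairs A" using A by (auto simp: pairs_def card_2_iff)
    then show "pairs e0 - pairs A \<noteq> {}" by blast
  qed (use \<alpha> s in auto)
  also have "- ?l * real (card (pairs e0)) - \<eta> - \<eta> = - real d + 1 + \<delta> - \<eta>"
  proof -
    have "- ?l * real (card (pairs e0)) = - real d + 1 + (real d - 1) / (real d + 1)"
      using e0_finite by (simp add: card_pairs of_nat_choose_two field_simps)
    then show ?thesis by (simp add: \<eta>)
  qed
  finally show ?thesis by (simp add: R_def power2_eq_square mult_ac)
qed

end

text \<open>The candidates are the \<open>d\<close>-cliques of the projection, which include all
  hyperedges. The expected number of the remaining cliques is bounded by summing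
  \<open>clique_prob_le\<close> over all \<open>d\<close>-sets.\<close>

lemma coin_entropy_diff_Proj_le:
  assumes d: "2 \<le> d" and n: "1 \<le> n" and p: "0 < p" "p < 1" "p \<le> \<alpha> * real n powr (- real d + 1 + \<delta>)"
    and \<alpha>: "0 \<le> \<alpha>" and \<delta>: "\<delta> \<le> (real d - 1) / (real d + 1)" and s: "0 < s" "s < 1"
  shows "coin_entropy p (d_subsets d n) (\<lambda>H. H) - coin_entropy p (d_subsets d n) (Proj n) \<le>
    real (n choose d) * (p * ln (1 / s) +
      (2 ^ d * \<alpha>) ^ 2 * (1 + 2 ^ d * \<alpha>) ^ (d choose 2) *
      real n powr (- real d + 1 + \<delta> - ((real d - 1) / (real d + 1) - \<delta>)) * ln (1 / (1 - s)))"
proof -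
  let ?U = "d_subsets d n" and ?K = "\<lambda>x. {e \<in> d_subsets d n. pairs e \<subseteq> x}"
  let ?r = "(2 ^ d * \<alpha>) ^ 2 * (1 + 2 ^ d * \<alpha>) ^ (d choose 2) *
      real n powr (- real d + 1 + \<delta> - ((real d - 1) / (real d + 1) - \<delta>))"
  have "coin_mean p ?U (\<lambda>H. real (card (?K (Proj n H) - H))) =
      (\<Sum>e\<in>?U. coin_prob p ?U (\<lambda>H. e \<in> ?K (Proj n H) - H))"
    by (intro coin_mean_card_set) auto
  also have "\<dots> \<le> (\<Sum>e\<in>?U. ?r)"
  proof (intro sum_mono)
    fix e assume e: "e \<in> ?U"
    \<comment> \<open>Deleting \<open>e\<close> inside \<open>?f\<close> makes it independent of the
      coin of \<open>e\<close> and changes nothing when \<open>e\<close> is absent.\<close>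
    let ?f = "\<lambda>H. of_bool (covers (H - {e}) (pairs e)) :: real"
    have "coin_prob p ?U (\<lambda>H. e \<in> ?K (Proj n H) - H) = coin_mean p ?U (\<lambda>H. of_bool (e \<notin> H) * ?f H)"
      unfolding coin_prob_def using e by (intro coin_mean_cong) (auto simp: covers_def Proj_eq)
    also have "\<dots> = (1 - p) * coin_mean p (?U - {e}) ?f"
      using e by (intro coin_mean_indep(3)) auto
    also have "coin_mean p (?U - {e}) ?f = coin_prob p (?U - {e}) (\<lambda>H. covers H (pairs e))"
      unfolding coin_prob_def by (intro coin_mean_cong) (simp add: Diff_triv subset_Diff_insert)
    also have "(1 - p) * \<dots> \<le> 1 * coin_prob p (?U - {e}) (\<lambda>H. covers H (pairs e))"
      using p by (intro mult_right_mono coin_prob_nonneg) auto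
    also have "\<dots> \<le> ?r"
      unfolding mult_1 using assms e by (intro clique_prob_le[OF n _ _ p(3) \<alpha> refl e d]) auto
    finally show "coin_prob p ?U (\<lambda>H. e \<in> ?K (Proj n H) - H) \<le> ?r" .
  qed
  finally have r: "coin_mean p ?U (\<lambda>H. real (card (?K (Proj n H) - H))) \<le> real (n choose d) * ?r"
    by (simp add: card_d_subsets)
  have "coin_entropy p ?U (\<lambda>H. H) - coin_entropy p ?U (Proj n) \<le>
      real (card ?U) * p * ln (1 / s) + coin_mean p ?U (\<lambda>H. real (card (?K (Proj n H) - H))) * ln (1 / (1 - s))"
    using p s by (intro coin_entropy_diff_set_le) (auto simp: Proj_eq)
  also have "\<dots> \<le> real (n choose d) * p * ln (1 / s) + real (n choose d) * ?r * ln (1 / (1 - s))"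
    using r s p by (intro add_mono mult_right_mono) (auto simp: card_d_subsets)
  finally show ?thesis by (simp only: distrib_left mult.assoc)
qed

section \<open>Asymptotics\<close>

lemma cond_entropy_Proj_nonneg: "0 \<le> cond_entropy_Proj d n p"
proof -
  interpret information_space "coin_space d n p" "exp 1" by (rule information_space_coin_space)
  show ?thesis
    unfolding cond_entropy_Proj_def shannon_cond_entropy_def
    by (intro conditional_entropy_nonneg simple_function_coin_space)
qed

text \<open>The absent elements contribute \<open>(1 - p) * ln (1 / (1 - p))\<close> each, which
  lies between 0 and \<open>p\<close>.\<close>

lemma coin_entropy_id_bounds:
  assumes "finite U" "0 < p" "p < 1"
  shows "real (card U) * p * ln (1 / p) \<le> coin_entropy p U (\<lambda>H. H)"
    and "coin_entropy p U (\<lambda>H. H) \<le> real (card U) * p * (ln (1 / p) + 1)"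
proof -
  have "ln (1 / (1 - p)) \<le> 1 / (1 - p) - 1" using assms by (intro ln_le_minus_one) auto
  then have "(1 - p) * ln (1 / (1 - p)) \<le> (1 - p) * (1 / (1 - p) - 1)"
    using assms by (intro mult_left_mono) auto
  also have "\<dots> = p" using assms by (simp add: right_diff_distrib)
  finally have le: "(1 - p) * ln (1 / (1 - p)) \<le> p" .
  have ge: "0 \<le> (1 - p) * ln (1 / (1 - p))" using assms by simp
  show "real (card U) * p * ln (1 / p) \<le> coin_entropy p U (\<lambda>H. H)"
    unfolding coin_entropy_id[OF assms] mult.assoc using ge by (intro mult_left_mono) auto
  show "coin_entropy p U (\<lambda>H. H) \<le> real (card U) * p * (ln (1 / p) + 1)"
    unfolding coin_entropy_id[OF assms] mult.assoc using le
    by (intro mult_left_mono) (auto simp: distrib_left)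
qed

lemma eventually_ln_ge:
  assumes "0 < (k::real)"
  shows "eventually (\<lambda>n. C \<le> k * ln (real n)) sequentially"
proof -
  have "filterlim (\<lambda>n. ln (real n)) at_top sequentially"
    by (rule filterlim_compose[OF ln_at_top filterlim_real_sequentially])
  then have "eventually (\<lambda>n. C / k \<le> ln (real n)) sequentially"
    by (simp add: filterlim_at_top)
  then show ?thesis
    by (rule eventually_mono) (use assms in \<open>simp add: field_simps\<close>)
qed

lemma eventually_powr_neg_le:
  assumes "0 < (k::real)" "0 < e"
  shows "eventually (\<lambda>n. C * real n powr (- k) \<le> e) sequentially"
proof -
  have "((\<lambda>n. C * real n powr (- k)) \<longlongrightarrow> C * 0) sequentially"
    using assms by (intro tendsto_mult tendsto_const tendsto_neg_powr filterlim_real_sequentially) auto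
  then have "eventually (\<lambda>n. C * real n powr (- k) < e) sequentially"
    using assms by (intro order_tendstoD(2)) auto
  then show ?thesis by eventually_elim simp
qed

section \<open>Estimates for the given sequence of probabilities\<close>

context
  fixes d :: nat and c \<delta> :: real and p \<epsilon> :: "nat \<Rightarrow> real"
  assumes d: "d \<ge> 3" and c: "c > 0" and \<delta>: "\<delta> < 1" and \<epsilon>: "\<epsilon> \<in> o(\<lambda>_. 1)"
    and p_eq: "\<And>n. n \<ge> 1 \<Longrightarrow> p n = (c + \<epsilon> n) * real n powr (- real d + 1 + \<delta>)"
begin

private abbreviation (input) "X n \<equiv> real n powr (1 + \<delta>)"
private abbreviation (input) "q n \<equiv> real ((n - 2) choose (d - 2)) * p n"
text \<open>\<open>a\<close> and \<open>g\<close> are the constants in the lower bounds for the mean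
  number of hyperedges and for \<open>q n\<close>. They combine
  \<open>p n \<ge> c / 2 * n powr (- d + 1 + \<delta>)\<close> with the bound
  \<open>(m / k) ^ k\<close> for binomial coefficients; for \<open>g\<close>,
  \<open>(n - 2) / (d - 2) \<ge> n / (2 * d)\<close> is used.\<close>

private definition "a = c / 2 / real d ^ d"
private definition "g = c / 2 / (2 * real d) ^ (d - 2)"

private lemma a_pos: "0 < a" and g_pos: "0 < g"
  using c d by (simp_all add: a_def g_def)

private lemma eventually_p_bounds:
  "eventually (\<lambda>n. c / 2 * real n powr (- real d + 1 + \<delta>) \<le> p n \<and>
     p n \<le> 2 * c * real n powr (- real d + 1 + \<delta>)) sequentially"
proof -
  have "eventually (\<lambda>n. norm (\<epsilon> n) \<le> c / 2 * norm (1::real)) sequentially"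
    using \<epsilon> c by (intro landau_o.smallD) auto
  then show ?thesis
    using eventually_ge_at_top[of 1]
  proof eventually_elim
    case (elim n)
    then have "c / 2 \<le> c + \<epsilon> n" "c + \<epsilon> n \<le> 2 * c" using c by auto
    then show ?case using elim by (auto simp: p_eq intro!: mult_right_mono)
  qed
qed

text \<open>All later estimates draw on this list: \<open>p n\<close>, \<open>q n\<close> and the
  mean number of hyperedges are powers of \<open>n\<close> up to constant factors, so the logarithms
  are linear in \<open>ln n\<close> up to additive constants. As \<open>\<delta> < 1\<close>,
  \<open>q n\<close> tends to 0.\<close>

private lemma eventually_basic:
  "eventually (\<lambda>n. 2 * d \<le> n \<and> 0 < p n \<and> p n < 1 \<and> 0 < q n \<and> q n \<le> 1 / 2 \<and>
     p n \<le> 2 * c * real n powr (- real d + 1 + \<delta>) \<and>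
     a * X n \<le> real (n choose d) * p n \<and> real (n choose d) * p n \<le> 2 * c * X n \<and>
     (real d - 1 - \<delta>) * ln (real n) - ln (2 * c) \<le> ln (1 / p n) \<and>
     ln (1 / p n) \<le> (real d - 1 - \<delta>) * ln (real n) - ln (c / 2) \<and>
     (1 - \<delta>) * ln (real n) - ln (2 * c) \<le> ln (1 / q n) \<and>
     ln (1 / q n) \<le> (1 - \<delta>) * ln (real n) - ln g) sequentially"
proof -
  have "eventually (\<lambda>n. 2 * c * real n powr (- (1 - \<delta>)) \<le> 1 / 2) sequentially"
    using \<delta> by (intro eventually_powr_neg_le) auto
  then show ?thesis
    using eventually_p_bounds eventually_ge_at_top[of "2 * d"]
  proof eventually_elim
    case (elim n)
    define N where "N = real n"
    let ?pw = "N powr (- real d + 1 + \<delta>)"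
    have n: "6 \<le> n" "2 * d \<le> n" using elim d by auto
    have N: "1 \<le> N" "0 < N" using n by (auto simp: N_def)
    have lo: "c / 2 * ?pw \<le> p n" and hi: "p n \<le> 2 * c * ?pw"
      using elim by (auto simp: N_def)
    have small: "2 * c * N powr (- (1 - \<delta>)) \<le> 1 / 2" using elim by (simp add: N_def)
    have pos: "0 < p n"
      using lo c N by (intro less_le_trans[OF _ lo] mult_pos_pos) auto
    have q_hi: "q n \<le> 2 * c * N powr (- (1 - \<delta>))"
    proof -
      have "real ((n - 2) choose (d - 2)) \<le> real ((n - 2) ^ (d - 2))"
        by (intro of_nat_mono choose_le_pow)
      also have "\<dots> \<le> N ^ (d - 2)" unfolding of_nat_power N_def by (intro power_mono) auto
      also have "\<dots> = N powr (real d - 2)" using N d by (simp add: powr_realpow[symmetric])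
      finally have "q n \<le> N powr (real d - 2) * (2 * c * ?pw)"
        using hi pos by (intro mult_mono) auto
      also have "\<dots> = 2 * c * N powr ((real d - 2) + (- real d + 1 + \<delta>))"
        by (simp only: powr_add mult_ac)
      finally show ?thesis by simp
    qed
    have q_lo: "g * N powr (- (1 - \<delta>)) \<le> q n"
    proof -
      have "N / 2 / real d \<le> real (n - 2) / real (d - 2)"
        using n d unfolding N_def by (intro frac_le) (auto simp: of_nat_diff)
      then have "(N / (2 * real d)) ^ (d - 2) \<le> (real (n - 2) / real (d - 2)) ^ (d - 2)"
        using N by (intro power_mono) auto
      also have "\<dots> \<le> real ((n - 2) choose (d - 2))"
        using n by (intro binomial_ge_n_over_k_pow_k) auto
      finally have le: "(N / (2 * real d)) ^ (d - 2) * (c / 2 * ?pw) \<le> q n"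
        using lo c N by (intro mult_mono) auto
      have "N ^ (d - 2) = N powr (real d - 2)" using N d by (simp add: powr_realpow[symmetric])
      then have "(N / (2 * real d)) ^ (d - 2) * (c / 2 * ?pw) = g * (N powr (real d - 2) * ?pw)"
        by (simp add: g_def power_divide mult_ac)
      also have "N powr (real d - 2) * ?pw = N powr (- (1 - \<delta>))"
        unfolding powr_add[symmetric] by (rule arg_cong) simp
      finally show ?thesis using le by (rule ord_eq_le_trans[OF sym])
    qed
    have q_pos: "0 < q n"
      using g_pos N by (intro less_le_trans[OF _ q_lo] mult_pos_pos) auto
    \<comment> \<open>Some \<open>d\<close>-set contains a given pair; this yields
      \<open>p n < 1\<close> from the bound on \<open>q n\<close>.\<close>
    have "p n \<le> q n"
    proof -
      have "1 \<le> (n - 2) choose (d - 2)" using n by (simp add: Suc_le_eq)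
      then have "1 * p n \<le> q n" using pos by (intro mult_right_mono) auto
      then show ?thesis by simp
    qed
    have q_half: "q n \<le> 1 / 2" using q_hi small by simp
    have NX: "N powr real d * ?pw = N powr (1 + \<delta>)"
      unfolding powr_add[symmetric] by (rule arg_cong) simp
    have Np_lo: "a * N powr (1 + \<delta>) \<le> real (n choose d) * p n"
    proof -
      have "(N / real d) ^ d \<le> real (n choose d)"
        using n unfolding N_def by (intro binomial_ge_n_over_k_pow_k) auto
      then have le: "(N / real d) ^ d * (c / 2 * ?pw) \<le> real (n choose d) * p n"
        using lo c N by (intro mult_mono) auto
      have "(N / real d) ^ d * (c / 2 * ?pw) = a * (N powr real d * ?pw)"
        using N by (simp add: a_def power_divide powr_realpow mult_ac)
      also note NX
      finally show ?thesis using le by (rule ord_eq_le_trans[OF sym])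
    qed
    have Np_hi: "real (n choose d) * p n \<le> 2 * c * N powr (1 + \<delta>)"
    proof -
      have "real (n choose d) \<le> real (n ^ d)" by (intro of_nat_mono choose_le_pow)
      also have "\<dots> = N powr real d" using N by (simp add: N_def powr_realpow)
      finally have "real (n choose d) * p n \<le> N powr real d * (2 * c * ?pw)"
        using hi pos by (intro mult_mono) auto
      also have "\<dots> = 2 * c * (N powr real d * ?pw)" by (simp only: mult_ac)
      finally show ?thesis unfolding NX .
    qed
    have ln_bounds: "- (k * ln N) - ln v \<le> ln (1 / x) \<and> ln (1 / x) \<le> - (k * ln N) - ln u"
      if "u * N powr k \<le> x" "x \<le> v * N powr k" "0 < u" "0 < v" for x u v k
    proof -
      have "0 < u * N powr k" using that(3) N by simp
      then have x: "0 < x" using that(1) by linarith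
      have "ln x \<le> ln (v * N powr k)" "ln (u * N powr k) \<le> ln x"
        by (rule ln_mono; fact)+
      moreover have "ln (w * N powr k) = ln w + k * ln N" if "0 < w" for w
        using that N by (simp add: ln_mult ln_powr)
      moreover have "ln (1 / x) = - ln x" using x by (simp add: ln_div)
      ultimately show ?thesis using that(3,4) by simp
    qed
    have c': "0 < c / 2" "0 < 2 * c" using c by simp_all
    have slopes: "- ((- real d + 1 + \<delta>) * ln N) = (real d - 1 - \<delta>) * ln N"
      "- (- (1 - \<delta>) * ln N) = (1 - \<delta>) * ln N"
      by (simp_all add: algebra_simps)
    have p_lt_1: "p n < 1" using \<open>p n \<le> q n\<close> q_half by linarith
    note ln_p = ln_bounds[OF lo hi c', unfolded slopes]
      and ln_q = ln_bounds[OF q_lo q_hi g_pos c'(2), unfolded slopes]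
    show ?case
      unfolding N_def[symmetric]
      by (intro conjI n(2) pos p_lt_1 q_pos q_half hi Np_lo Np_hi
          ln_p[THEN conjunct1] ln_p[THEN conjunct2] ln_q[THEN conjunct1] ln_q[THEN conjunct2])
  qed
qed

text \<open>Double counting of pairs inside \<open>d\<close>-sets.\<close>

private lemma choose_eq: "2 * d \<le> n \<Longrightarrow> real (n choose 2) * q n = real (n choose d) * p n * real (d choose 2)"
  using choose_mult[of 2 d n] d by (simp add: mult_ac flip: of_nat_mult)

private lemma eventually_entropy_le:
  "eventually (\<lambda>n. coin_entropy (p n) (d_subsets d n) (\<lambda>H. H) \<le>
     4 * c * (real d - 1 - \<delta>) * (X n * ln (real n))) sequentially"
proof -
  have "eventually (\<lambda>n. 1 - ln (c / 2) \<le> (real d - 1 - \<delta>) * ln (real n)) sequentially"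
    using d \<delta> by (intro eventually_ln_ge) auto
  then show ?thesis using eventually_basic
  proof eventually_elim
    case (elim n)
    have ln_le: "0 \<le> ln (1 / p n) + 1" "ln (1 / p n) + 1 \<le> 2 * ((real d - 1 - \<delta>) * ln (real n))"
      using elim by (intro add_nonneg_nonneg; auto) (use elim in linarith)
    have "coin_entropy (p n) (d_subsets d n) (\<lambda>H. H) \<le> real (n choose d) * p n * (ln (1 / p n) + 1)"
      using coin_entropy_id_bounds(2)[of "d_subsets d n" "p n"] elim by (simp add: card_d_subsets)
    also have "\<dots> \<le> 2 * c * X n * (2 * ((real d - 1 - \<delta>) * ln (real n)))"
      using elim ln_le c by (intro mult_mono[OF _ ln_le(2)]) auto
    also have "\<dots> = 4 * c * (real d - 1 - \<delta>) * (X n * ln (real n))" by simp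
    finally show ?case .
  qed
qed

private lemma eventually_entropy_Proj_ge:
  "eventually (\<lambda>n. a * ((1 - \<delta>) / 4) * (X n * ln (real n)) \<le> entropy_Proj d n (p n)) sequentially"
proof -
  \<comment> \<open>Absorbing \<open>ln (2 * c)\<close> costs half of the slope
    \<open>1 - \<delta>\<close>; the other half in the constant comes from
    \<open>coin_entropy_Proj_ge\<close>.\<close>
  have "eventually (\<lambda>n. ln (2 * c) \<le> (1 - \<delta>) / 2 * ln (real n)) sequentially"
    using \<delta> by (intro eventually_ln_ge) auto
  then show ?thesis using eventually_basic
  proof eventually_elim
    case (elim n)
    have D: "real (d choose 2) > 0" using d by simp
    have "0 \<le> ln (real n)" using elim d by simp
    have "a * ((1 - \<delta>) / 4) * (X n * ln (real n)) = (a * X n) * ((1 - \<delta>) / 2 * ln (real n) / 2)" by simp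
    also have "\<dots> \<le> (real (n choose d) * p n) * (ln (1 / q n) / 2)"
      using elim \<open>0 \<le> ln (real n)\<close> \<delta> a_pos by - (rule mult_mono, auto)
    also have "\<dots> = real (n choose 2) * q n / 2 * ln (1 / q n) / real (d choose 2)"
      using choose_eq[of n] elim D by (simp add: field_simps)
    also have "\<dots> \<le> entropy_Proj d n (p n)"
      using elim d by (subst entropy_Proj_eq, simp, simp, intro coin_entropy_Proj_ge) auto
    finally show ?case .
  qed
qed

private lemma eventually_cond_entropy_ge:
  assumes "\<delta> > (real d - 1) / (real d + 1)"
  shows "\<exists>k>0. eventually (\<lambda>n. k * (X n * ln (real n)) \<le> cond_entropy_Proj d n (p n)) sequentially"
proof -
  let ?D = "real (d choose 2)"
  \<comment> \<open>The slopes of \<open>ln (1 / p n)\<close> and \<open>ln (1 / q n)\<close> in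
    \<open>ln n\<close> are \<open>d - 1 - \<delta>\<close> and \<open>1 - \<delta>\<close>, and a
    hyperedge has \<open>?D\<close> pairs, so \<open>k\<close> is the slope of the entropy lost per
    hyperedge in this bound. The factorisation of \<open>2 * k\<close> shows that it is positive
    above the critical \<open>\<delta>\<close>.\<close>
  define k where "k = (real d - 1 - \<delta>) - ?D * (1 - \<delta>)"
  have "2 * k = (real d - 2) * (\<delta> * (real d + 1) - (real d - 1))"
    by (simp add: k_def of_nat_choose_two field_simps)
  moreover have "\<dots> > 0"
    using assms d by (intro mult_pos_pos) (auto simp: pos_divide_less_eq)
  ultimately have k: "0 < k" by simp
  have "eventually (\<lambda>n. ln (2 * c) - ?D * ln g + 2 * ?D \<le> k / 2 * ln (real n)) sequentially"
    using k by (intro eventually_ln_ge) auto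
  then have "eventually (\<lambda>n. a * (k / 2) * (X n * ln (real n)) \<le> cond_entropy_Proj d n (p n)) sequentially"
    using eventually_basic
  proof eventually_elim
    case (elim n)
    have "0 \<le> ln (real n)" using elim d by simp
    define T where "T = ln (real n)"
    have "?D * ln (1 / q n) \<le> ?D * ((1 - \<delta>) * T - ln g)"
      using elim unfolding T_def by (intro mult_left_mono) auto
    moreover have "?D * ((1 - \<delta>) * T - ln g) = ?D * (1 - \<delta>) * T - ?D * ln g"
      by (simp add: algebra_simps)
    moreover have "(real d - 1 - \<delta>) * T = k * T + ?D * (1 - \<delta>) * T"
      by (simp add: k_def algebra_simps)
    moreover have "(real d - 1 - \<delta>) * T - ln (2 * c) \<le> ln (1 / p n)"
      "ln (2 * c) - ?D * ln g + 2 * ?D \<le> k / 2 * T"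
      using elim by (auto simp: T_def)
    moreover have "?D * (ln (1 / q n) + 2) = ?D * ln (1 / q n) + 2 * ?D" "k / 2 * T = (k * T) / 2"
      by (simp_all add: algebra_simps)
    ultimately have "k / 2 * T \<le> ln (1 / p n) - ?D * (ln (1 / q n) + 2)"
      by linarith
    then have bracket: "k / 2 * ln (real n) \<le> ln (1 / p n) - ?D * (ln (1 / q n) + 2)"
      by (simp add: T_def)
    have "a * (k / 2) * (X n * ln (real n)) = (a * X n) * (k / 2 * ln (real n))" by simp
    also have "\<dots> \<le> (real (n choose d) * p n) * (ln (1 / p n) - ?D * (ln (1 / q n) + 2))"
      using elim \<open>0 \<le> ln (real n)\<close> bracket k a_pos by - (rule mult_mono, auto)
    also have "\<dots> = real (n choose d) * p n * ln (1 / p n) - real (n choose 2) * q n * (ln (1 / q n) + 2)"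
      using choose_eq[of n] elim by (simp only: right_diff_distrib mult.assoc[symmetric])
    also have "\<dots> \<le> coin_entropy (p n) (d_subsets d n) (\<lambda>H. H) - coin_entropy (p n) (d_subsets d n) (Proj n)"
      using coin_entropy_id_bounds(1)[of "d_subsets d n" "p n"]
        coin_entropy_Proj_le[of d "p n" "q n" n] elim d
      by (intro diff_mono) (auto simp: card_d_subsets)
    also have "\<dots> = cond_entropy_Proj d n (p n)"
      using elim by (simp add: cond_entropy_Proj_eq)
    finally show ?case .
  qed
  then show ?thesis using k a_pos by (intro exI[of _ "a * (k / 2)"]) auto
qed

text \<open>The parameter \<open>s\<close> stays free: \<open>1 / 2\<close> serves at the critical
  \<open>\<delta>\<close>, a value near 1 below it.\<close>

private lemma eventually_cond_entropy_le:
  assumes "\<delta> \<le> (real d - 1) / (real d + 1)"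
  obtains K where "\<And>s. 0 < s \<Longrightarrow> s < 1 \<Longrightarrow> eventually (\<lambda>n. cond_entropy_Proj d n (p n) \<le>
     (2 * c * ln (1 / s) + K * ln (1 / (1 - s)) * real n powr (- ((real d - 1) / (real d + 1) - \<delta>))) * X n) sequentially"
proof -
  define K where "K = (2 ^ d * (2 * c)) ^ 2 * (1 + 2 ^ d * (2 * c)) ^ (d choose 2)"
  let ?\<eta> = "(real d - 1) / (real d + 1) - \<delta>"
  have K: "0 \<le> K" using c by (simp add: K_def)
  show ?thesis
  proof (rule that)
    fix s :: real assume s: "0 < s" "s < 1"
    show "eventually (\<lambda>n. cond_entropy_Proj d n (p n) \<le>
     (2 * c * ln (1 / s) + K * ln (1 / (1 - s)) * real n powr (- ?\<eta>)) * X n) sequentially"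
      using eventually_basic
    proof eventually_elim
      case (elim n)
      have n: "1 \<le> n" using elim d by simp
      have "cond_entropy_Proj d n (p n) =
          coin_entropy (p n) (d_subsets d n) (\<lambda>H. H) - coin_entropy (p n) (d_subsets d n) (Proj n)"
        using elim by (simp add: cond_entropy_Proj_eq)
      also have "\<dots> \<le> real (n choose d) * (p n * ln (1 / s) +
          K * real n powr (- real d + 1 + \<delta> - ?\<eta>) * ln (1 / (1 - s)))"
        unfolding K_def using elim d c assms n s by (intro coin_entropy_diff_Proj_le) auto
      also have "\<dots> = (real (n choose d) * p n) * ln (1 / s) +
          real (n choose d) * (K * real n powr (- real d + 1 + \<delta> - ?\<eta>) * ln (1 / (1 - s)))"
        by (simp add: distrib_left)
      also have "\<dots> \<le> (2 * c * X n) * ln (1 / s) +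
          real n powr real d * (K * real n powr (- real d + 1 + \<delta> - ?\<eta>) * ln (1 / (1 - s)))"
      proof (intro add_mono mult_right_mono)
        have "real (n choose d) \<le> real (n ^ d)" by (intro of_nat_mono choose_le_pow)
        then show "real (n choose d) \<le> real n powr real d" using n by (simp add: powr_realpow)
      qed (use elim s K in auto)
      also have "real n powr real d * (K * real n powr (- real d + 1 + \<delta> - ?\<eta>) * ln (1 / (1 - s))) =
          K * ln (1 / (1 - s)) * real n powr (real d + (- real d + 1 + \<delta> - ?\<eta>))"
        by (simp only: powr_add mult_ac)
      also have "real d + (- real d + 1 + \<delta> - ?\<eta>) = - ?\<eta> + (1 + \<delta>)" by simp
      also have "real n powr \<dots> = real n powr (- ?\<eta>) * X n" by (rule powr_add)
      finally show ?case by (simp only: distrib_left distrib_right mult_ac)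
    qed
  qed
qed

lemma entropy_asymptotics:
  shows "(\<lambda>n. entropy_Proj d n (p n)) \<in> \<Theta>(\<lambda>n. real n powr (1 + \<delta>) * ln (real n))" (is ?T1)
    and "\<delta> < (real d - 1) / (real d + 1) \<Longrightarrow>
       (\<lambda>n. cond_entropy_Proj d n (p n)) \<in> o(\<lambda>n. real n powr (1 + \<delta>))"
    and "\<delta> = (real d - 1) / (real d + 1) \<Longrightarrow>
       (\<lambda>n. cond_entropy_Proj d n (p n)) \<in> O(\<lambda>n. real n powr (1 + \<delta>))"
    and "\<delta> > (real d - 1) / (real d + 1) \<Longrightarrow>
       (\<lambda>n. cond_entropy_Proj d n (p n)) \<in> \<Theta>(\<lambda>n. real n powr (1 + \<delta>) * ln (real n))"
proof -
  let ?H = "\<lambda>n. coin_entropy (p n) (d_subsets d n) (\<lambda>H. H)"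
  \<comment> \<open>The two entropies are nonnegative and add up to that of the hypergraph, so one
    upper bound serves both.\<close>
  have upper: "eventually (\<lambda>n. ?H n \<le> 4 * c * (real d - 1 - \<delta>) * \<bar>X n * ln (real n)\<bar> \<and>
      cond_entropy_Proj d n (p n) + entropy_Proj d n (p n) = ?H n \<and>
      0 \<le> entropy_Proj d n (p n) \<and> 0 \<le> ln (real n)) sequentially"
    using eventually_entropy_le eventually_entropy_Proj_ge eventually_basic
  proof eventually_elim
    case (elim n)
    have ln: "0 \<le> ln (real n)" using elim d by simp
    then have "\<bar>X n * ln (real n)\<bar> = X n * ln (real n)" by simp
    moreover have "0 \<le> a * ((1 - \<delta>) / 4) * (X n * ln (real n))" using a_pos \<delta> ln by simp
    then have "0 \<le> entropy_Proj d n (p n)" using elim(2) by (rule order_trans)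
    moreover have "cond_entropy_Proj d n (p n) + entropy_Proj d n (p n) = ?H n"
      using elim by (simp add: cond_entropy_Proj_eq entropy_Proj_eq)
    ultimately show ?case using elim(1) ln by simp
  qed
  note cond_nonneg = cond_entropy_Proj_nonneg
  show ?T1
  proof (rule bigthetaI)
    show "(\<lambda>n. entropy_Proj d n (p n)) \<in> O(\<lambda>n. X n * ln (real n))"
    proof (rule bigoI)
      show "eventually (\<lambda>n. norm (entropy_Proj d n (p n)) \<le>
          4 * c * (real d - 1 - \<delta>) * norm (X n * ln (real n))) sequentially"
        using upper
      proof eventually_elim
        case (elim n)
        then show ?case using cond_nonneg[of d n "p n"] unfolding real_norm_def by linarith
      qed
    qed
    show "(\<lambda>n. entropy_Proj d n (p n)) \<in> \<Omega>(\<lambda>n. X n * ln (real n))"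
    proof (rule landau_omega.bigI)
      show "0 < a * ((1 - \<delta>) / 4)" using a_pos \<delta> by simp
      show "eventually (\<lambda>n. a * ((1 - \<delta>) / 4) * norm (X n * ln (real n)) \<le>
          norm (entropy_Proj d n (p n))) sequentially"
        using upper eventually_entropy_Proj_ge by eventually_elim simp
    qed
  qed
  show "(\<lambda>n. cond_entropy_Proj d n (p n)) \<in> \<Theta>(\<lambda>n. X n * ln (real n))"
    if gt: "\<delta> > (real d - 1) / (real d + 1)"
  proof (rule bigthetaI)
    show "(\<lambda>n. cond_entropy_Proj d n (p n)) \<in> O(\<lambda>n. X n * ln (real n))"
    proof (rule bigoI)
      show "eventually (\<lambda>n. norm (cond_entropy_Proj d n (p n)) \<le>
          4 * c * (real d - 1 - \<delta>) * norm (X n * ln (real n))) sequentially"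
        using upper
      proof eventually_elim
        case (elim n)
        then show ?case using cond_nonneg[of d n "p n"] unfolding real_norm_def by linarith
      qed
    qed
    obtain k where k: "0 < k"
      "eventually (\<lambda>n. k * (X n * ln (real n)) \<le> cond_entropy_Proj d n (p n)) sequentially"
      using eventually_cond_entropy_ge[OF gt] by auto
    show "(\<lambda>n. cond_entropy_Proj d n (p n)) \<in> \<Omega>(\<lambda>n. X n * ln (real n))"
    proof (rule landau_omega.bigI[OF k(1)])
      show "eventually (\<lambda>n. k * norm (X n * ln (real n)) \<le>
          norm (cond_entropy_Proj d n (p n))) sequentially"
        using upper k(2) by eventually_elim (simp add: cond_nonneg)
    qed
  qed
  show "(\<lambda>n. cond_entropy_Proj d n (p n)) \<in> O(X)" if eq: "\<delta> = (real d - 1) / (real d + 1)"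
  proof -
    obtain K where K: "\<And>s. 0 < s \<Longrightarrow> s < 1 \<Longrightarrow> eventually (\<lambda>n. cond_entropy_Proj d n (p n) \<le>
        (2 * c * ln (1 / s) + K * ln (1 / (1 - s)) * real n powr (- ((real d - 1) / (real d + 1) - \<delta>))) * X n) sequentially"
      using eventually_cond_entropy_le[OF eq_refl[OF eq]] by blast
    have half: "0 < (1 / 2 :: real)" "1 / 2 < (1 :: real)" by simp_all
    have "eventually (\<lambda>n. norm (cond_entropy_Proj d n (p n)) \<le> (2 * c * ln 2 + K * ln 2) * norm (X n)) sequentially"
      using K[OF half] eventually_ge_at_top[of 1]
    proof eventually_elim
      case (elim n)
      \<comment> \<open>The exponent vanishes at the critical \<open>\<delta>\<close>;
        \<open>n \<ge> 1\<close> matters because \<open>0 powr 0 = 0\<close>.\<close>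
      have "real n powr (- ((real d - 1) / (real d + 1) - \<delta>)) = 1" using elim eq by simp
      then show ?case using elim by (simp add: cond_nonneg)
    qed
    then show ?thesis by (rule bigoI)
  qed
  show "(\<lambda>n. cond_entropy_Proj d n (p n)) \<in> o(X)" if lt: "\<delta> < (real d - 1) / (real d + 1)"
  proof (rule landau_o.smallI)
    fix e :: real assume e: "0 < e"
    \<comment> \<open>Chosen so that the hyperedges cost exactly \<open>e / 2\<close>; the other
      half is left for the vanishing contribution of the other cliques.\<close>
    define s where "s = exp (- (e / (4 * c)))"
    have s: "0 < s" "s < 1" "ln (1 / s) = e / (4 * c)"
      using e c by (auto simp: s_def ln_div)
    obtain K where K: "\<And>s. 0 < s \<Longrightarrow> s < 1 \<Longrightarrow> eventually (\<lambda>n. cond_entropy_Proj d n (p n) \<le>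
        (2 * c * ln (1 / s) + K * ln (1 / (1 - s)) * real n powr (- ((real d - 1) / (real d + 1) - \<delta>))) * X n) sequentially"
      using eventually_cond_entropy_le[OF less_imp_le[OF lt]] by blast
    have "eventually (\<lambda>n. K * ln (1 / (1 - s)) * real n powr (- ((real d - 1) / (real d + 1) - \<delta>)) \<le> e / 2) sequentially"
      using lt e by (intro eventually_powr_neg_le) auto
    then show "eventually (\<lambda>n. norm (cond_entropy_Proj d n (p n)) \<le> e * norm (X n)) sequentially"
      using K[OF s(1,2)]
    proof eventually_elim
      case (elim n)
      have "2 * c * ln (1 / s) = e / 2" using c by (simp add: s(3))
      then have "2 * c * ln (1 / s) + K * ln (1 / (1 - s)) * real n powr (- ((real d - 1) / (real d + 1) - \<delta>)) \<le> e"
        using elim(1) by linarith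
      then have "(2 * c * ln (1 / s) + K * ln (1 / (1 - s)) * real n powr (- ((real d - 1) / (real d + 1) - \<delta>))) * X n \<le> e * X n"
        by (rule mult_right_mono) simp
      then show ?case using elim(2) by (simp add: cond_nonneg)
    qed
  qed
qed

end

theorem theorem41:
  fixes d :: nat and c \<delta> :: real and p \<epsilon> :: "nat \<Rightarrow> real"
  assumes "d \<ge> 3" and "c > 0" and "\<delta> < 1"
    and "\<epsilon> \<in> o(\<lambda>_. 1)"
    and "\<And>n. n \<ge> 1 \<Longrightarrow> p n = (c + \<epsilon> n) * real n powr (- real d + 1 + \<delta>)"
    and "\<And>n. 0 \<le> p n \<and> p n \<le> 1"
  shows "(\<lambda>n. entropy_Proj d n (p n)) \<in> \<Theta>(\<lambda>n. real n powr (1 + \<delta>) * ln (real n)) \<and>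
    (\<delta> < (real d - 1) / (real d + 1) \<longrightarrow>
       (\<lambda>n. cond_entropy_Proj d n (p n)) \<in> o(\<lambda>n. real n powr (1 + \<delta>))) \<and>
    (\<delta> = (real d - 1) / (real d + 1) \<longrightarrow>
       (\<lambda>n. cond_entropy_Proj d n (p n)) \<in> O(\<lambda>n. real n powr (1 + \<delta>))) \<and>
    (\<delta> > (real d - 1) / (real d + 1) \<longrightarrow>
       (\<lambda>n. cond_entropy_Proj d n (p n)) \<in> \<Theta>(\<lambda>n. real n powr (1 + \<delta>) * ln (real n)))"
  using entropy_asymptotics[OF assms(1-5)] by (intro conjI impI)

end
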